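(* Let $d\ge2$ and let $\mathcal{L}=-\mathrm{div}(A\nabla)$, where $A=(a_{ij}(X))$ is a $C^\infty$, real, symmetric $(d+1)\times(d+1)$ matrix on $\mathbb{R}^{d+1}$ with $\mu|\xi|^2\le a_{ij}(X)\xi_i\xi_j\le\mu^{-1}|\xi|^2$ for all $X,\xi\in\mathbb{R}^{d+1}$ ($\mu>0$) and $A(x,t+1)=A(x,t)$ for all $(x,t)\in\mathbb{R}^d\times\mathbb{R}$. Then there exists $C=C(d,\mu)>0$ such that $$\int_0^1\int_{B(x_0,R)}|\nabla u|^2\,dx\,dt\le C\int_{B(x_0,2R)}|\nabla_xf|^2\,dx+\frac CR\iint_{T(x_0,3R)\setminus T(x_0,R)}|\nabla u|^2\,dx\,dt,$$ whenever $x_0\in\mathbb{R}^d$, $R>10$, $u\in C^1(\overline{T(x_0,3R)})\cap C^2(T(x_0,3R))$ is a solution to $\mathcal{L}(u)=0$ in $T(x_0,3R)$ and $u=f$ on $B(x_0,3R)\times\{0\}$.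
   Context: Repeated indices are summed from $1$ to $d+1$. $B(x,r)$ is the ball in $\mathbb{R}^d$, $T(x,r)=B(x,r)\times(0,r)$, $\nabla$ is the gradient in $\mathbb{R}^{d+1}$ and $\nabla_x$ the gradient in $\mathbb{R}^d$. *)

theory Defs
  imports "HOL-Analysis.Analysis"
begin

text \<open>
  Points of $R^{d+1}$ are pairs $X = (x,t)$ with \<open>x :: real ^ 'n\<close>, $d$ being \<open>CARD('n)\<close>.
  The $d+1$ coordinate directions are indexed by \<open>'n option\<close>: \<open>Some k\<close> is the direction of
  $x_k$ and \<open>None\<close> is the direction of $t$, the last one. Vectors of components, such as
  gradients, have type \<open>real ^ 'n option\<close>.
\<close>

fun coord_dir :: "'n::finite option \<Rightarrow> (real ^ 'n) \<times> real" where
  "coord_dir (Some k) = (axis k 1, 0)"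
| "coord_dir None = (0, 1)"

definition partial_deriv :: "'n::finite option \<Rightarrow> ((real ^ 'n) \<times> real \<Rightarrow> real) \<Rightarrow> (real ^ 'n) \<times> real \<Rightarrow> real"
  where "partial_deriv i u X = frechet_derivative u (at X) (coord_dir i)"

definition grad :: "((real ^ 'n::finite) \<times> real \<Rightarrow> real) \<Rightarrow> (real ^ 'n) \<times> real \<Rightarrow> real ^ 'n option"
  where "grad u X = (\<chi> i. partial_deriv i u X)"

definition grad_x :: "(real ^ 'n::finite \<Rightarrow> real) \<Rightarrow> real ^ 'n \<Rightarrow> real ^ 'n"
  where "grad_x f x = (\<chi> k. frechet_derivative f (at x) (axis k 1))"

definition divergence :: "((real ^ 'n::finite) \<times> real \<Rightarrow> real ^ 'n option) \<Rightarrow> (real ^ 'n) \<times> real \<Rightarrow> real"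
  where "divergence F X = (\<Sum>i\<in>UNIV. partial_deriv i (\<lambda>Y. F Y $ i) X)"

definition elliptic_op ::
  "((real ^ 'n::finite) \<times> real \<Rightarrow> real ^ 'n option ^ 'n option) \<Rightarrow>
     ((real ^ 'n) \<times> real \<Rightarrow> real) \<Rightarrow> (real ^ 'n) \<times> real \<Rightarrow> real"
  where "elliptic_op A u X = - divergence (\<lambda>Y. A Y *v grad u Y) X"

definition cyl :: "real ^ 'n::finite \<Rightarrow> real \<Rightarrow> ((real ^ 'n) \<times> real) set"
  where "cyl x r = ball x r \<times> {0<..<r}"

text \<open>
  Meant for open sets \<open>S\<close>; continuity of the derivatives of order below \<open>k\<close> follows from their
  differentiability.
\<close>

primrec Ck_on :: "nat \<Rightarrow> ((real ^ 'n::finite) \<times> real) set \<Rightarrow> ((real ^ 'n) \<times> real \<Rightarrow> real) \<Rightarrow> bool" where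
  "Ck_on 0 S u \<longleftrightarrow> continuous_on S u"
| "Ck_on (Suc k) S u \<longleftrightarrow>
     (\<forall>X\<in>S. u differentiable (at X)) \<and> (\<forall>i. Ck_on k S (partial_deriv i u))"

text \<open>
  The class $C^1$ of the closure of an open set \<open>S\<close>: \<open>u\<close> is $C^1$ in \<open>S\<close>, it is continuous on
  the closure, and its first partial derivatives have continuous extensions to the closure.
  Nothing is required of \<open>u\<close> outside the closure, where it takes arbitrary values; hence the
  partial derivatives at boundary points are not referred to.
\<close>

definition C1_closure :: "((real ^ 'n::finite) \<times> real) set \<Rightarrow> ((real ^ 'n) \<times> real \<Rightarrow> real) \<Rightarrow> bool"
  where "C1_closure S u \<longleftrightarrow>
    Ck_on 1 S u \<and> continuous_on (closure S) u \<and>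
    (\<forall>i. \<exists>g. continuous_on (closure S) g \<and> (\<forall>X\<in>S. g X = partial_deriv i u X))"

definition smooth_matrix :: "((real ^ 'n::finite) \<times> real \<Rightarrow> real ^ 'n option ^ 'n option) \<Rightarrow> bool"
  where "smooth_matrix A \<longleftrightarrow> (\<forall>i j k. Ck_on k UNIV (\<lambda>X. A X $ i $ j))"

definition elliptic_matrix :: "real \<Rightarrow> ((real ^ 'n::finite) \<times> real \<Rightarrow> real ^ 'n option ^ 'n option) \<Rightarrow> bool"
  where "elliptic_matrix \<mu> A \<longleftrightarrow>
    (\<forall>X \<xi>. \<mu> * (norm \<xi>)\<^sup>2 \<le> (\<Sum>i\<in>UNIV. \<Sum>j\<in>UNIV. A X $ i $ j * \<xi> $ i * \<xi> $ j) \<and>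
           (\<Sum>i\<in>UNIV. \<Sum>j\<in>UNIV. A X $ i $ j * \<xi> $ i * \<xi> $ j) \<le> inverse \<mu> * (norm \<xi>)\<^sup>2)"

end

theory Submission
  imports Defs
begin

text \<open>
  Write $p = \nabla u$ and $e_X(\xi) = A(X)\xi\cdot\xi$. Fix a height $0 < a < 1$ and test the equation in
  $\{t > a\}$ with $\varphi w$, where $\varphi$ is a cutoff of size $R$ and
  $w(x,t) = u(x,t) - u(x,\max(t-1,a))$ is the difference of $u$ and its translate by one period, the
  translate being continued by the boundary value $u(x,a)$ in the first period. As $w$ vanishes at $t = a$,
  no boundary term appears, and $\nabla w = p - r$, where $r(x,t)$ is $p(x,t-1)$ for $t > 1+a$ and
  $(\nabla_x u(x,a),0)$ in the slab $a < t \le 1+a$. By the symmetry of $A$,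
  \[ 2 A p\cdot(p-r) = e(p) + e(p-r) - e(r). \]
  Periodicity enters here: $e(r)$ above the slab is the translate of $e(p)$ by one period, so the integrals of
  $\varphi e(r)$ over $\{t > 1+a\}$ and of $\varphi e(p)$ over $\{t > a\}$ cancel up to the
  replacement of $\varphi(x,t)$ by $\varphi(x,t+1)$. Since $\varphi$ does not increase in $t$, the
  remainder has a favourable sign. What is left is
  \[ \int\varphi\, e(p-r) \le \int_{\mathrm{slab}} \varphi\, e(\nabla_x u(\cdot,a),0)
     - 2\int w\, A p\cdot\nabla\varphi. \]
  The left-hand side controls $|p - r|^2$, hence $|p|^2$, in the slab over $B(x_0,R)$. In the last term
  $|\nabla\varphi| \le 8/R$, the support of $\nabla\varphi$ over $B(x_0,R)$
  lies more than one period above the top of $T(x_0,R)$, and $|w|^2$ is at most the integral of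
  $|\partial_t u|^2$ over the preceding period; so this term is at most $C/R$ times the integral of $|\nabla u|^2$ over $T(x_0,2R)\setminus T(x_0,R)$.
  
  This is \<open>cutoff_energy_inequality\<close>, which rests on \<open>weak_identity\<close> and
  \<open>integral_lag_diff_sq_le\<close>. All of it takes place in a compact part of $T(x_0,3R)$, where $u$ is
  of class $C^2$. The theorem follows as $a \to 0$; the only thing used up to the boundary is that
  $u$ and its first derivatives extend continuously, which also makes $f$ differentiable with
  gradient the limit of $\nabla_x u(\cdot,a)$ (\<open>grad_x_eq_tangential\<close>).
\<close>

section \<open>A cutoff function on the line\<close>



definition pos_sq :: "real \<Rightarrow> real" where "pos_sq s = (max 0 s)\<^sup>2"

lemma DERIV_pos_sq: "(pos_sq has_real_derivative 2 * max 0 s) (at s)"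
proof -
  have *: "(\<lambda>h. (pos_sq (s + h) - pos_sq s - 2 * max 0 s * h)/h) \<midarrow>0\<rightarrow> 0"
  proof (rule Lim_null_comparison)
    have "\<bar>pos_sq (s + h) - pos_sq s - 2 * max 0 s * h\<bar> \<le> h\<^sup>2" for h
    proof -
      have "s < 0 \<Longrightarrow> 0 \<le> s + h \<Longrightarrow> (s + h)\<^sup>2 \<le> h\<^sup>2" by (intro power_mono) auto
      moreover have "s * s + 2 * s * h + h * h \<ge> 0"
        using zero_le_power2[of "s + h"] by (simp add: power2_eq_square algebra_simps)
      moreover have "0 \<le> s \<Longrightarrow> s + h < 0 \<Longrightarrow> s * (s + 2 * h) \<le> 0"
        by (intro mult_nonneg_nonpos) auto
      ultimately show ?thesis
        by (auto simp: pos_sq_def max_def power2_eq_square algebra_simps abs_if)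
    qed
    then have "\<bar>(pos_sq (s + h) - pos_sq s - 2 * max 0 s * h)/h\<bar> \<le> \<bar>h\<bar>" for h
      by (cases "h = 0") (auto simp: field_simps power2_eq_square)
    then show "eventually (\<lambda>h. norm ((pos_sq (s + h) - pos_sq s - 2 * max 0 s * h)/h) \<le> \<bar>h\<bar>) (at 0)"
      by auto
    show "((\<lambda>h. \<bar>h\<bar>) \<longlongrightarrow> 0) (at (0::real))" by (intro tendsto_eq_intros) auto
  qed
  have "(\<lambda>h. (pos_sq (s + h) - pos_sq s)/h) \<midarrow>0\<rightarrow> 2 * max 0 s"
    using tendsto_add[OF * tendsto_const[of "2 * max 0 s"]]
    by (rule Lim_transform_eventually[THEN tendsto_eq_rhs])
      (auto simp: eventually_at field_simps intro: exI[of _ 1])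
  then show ?thesis by (simp add: DERIV_def)
qed

text \<open>
  Composing squares of positive parts gives a step of class $C^1$ whose derivative has one formula on the
  whole line, so that no case distinctions occur at the points $0$ and $1$ where the step
  becomes constant.
\<close>

definition cutoff :: "real \<Rightarrow> real" where "cutoff p = pos_sq (1 - pos_sq (1 - p))"
definition cutoff' :: "real \<Rightarrow> real"
  where "cutoff' p = 4 * max 0 (1 - pos_sq (1 - p)) * max 0 (1 - p)"

lemma DERIV_cutoff: "(cutoff has_real_derivative cutoff' p) (at p)"
proof -
  have "((\<lambda>p. pos_sq (1 - p)) has_real_derivative 2 * max 0 (1 - p) * (0 - 1)) (at p)"
    by (rule DERIV_chain2[OF DERIV_pos_sq]) (intro derivative_intros)
  then have "((\<lambda>p. 1 - pos_sq (1 - p)) has_real_derivative 0 - 2 * max 0 (1 - p) * (0 - 1)) (at p)"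
    by (intro derivative_intros)
  from DERIV_chain2[OF DERIV_pos_sq this] show ?thesis
    by (simp add: cutoff_def [abs_def] cutoff'_def mult.assoc)
qed

lemma continuous_cutoff': "continuous_on UNIV cutoff'"
  unfolding cutoff'_def [abs_def] pos_sq_def by (intro continuous_intros)

lemma cutoff_le_0: "p \<le> 0 \<Longrightarrow> cutoff p = 0" "p \<le> 0 \<Longrightarrow> cutoff' p = 0"
proof -
  assume "p \<le> 0"
  then have "1 - pos_sq (1 - p) \<le> 0" by (simp add: pos_sq_def one_le_power)
  then have "max 0 (1 - pos_sq (1 - p)) = 0" by simp
  then show "cutoff p = 0" "cutoff' p = 0" by (simp_all add: cutoff_def cutoff'_def pos_sq_def[of "1 - pos_sq (1 - p)"])
qed

lemma cutoff_ge_1: "p \<ge> 1 \<Longrightarrow> cutoff p = 1" "p \<ge> 1 \<Longrightarrow> cutoff' p = 0"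
  by (auto simp: cutoff_def cutoff'_def pos_sq_def)

lemma cutoff'_bounds: "0 \<le> cutoff' p" "cutoff' p \<le> 4"
proof -
  show "0 \<le> cutoff' p" by (simp add: cutoff'_def)
  show "cutoff' p \<le> 4"
  proof (cases "p \<le> 0")
    case False
    then have "max 0 (1 - pos_sq (1 - p)) * max 0 (1 - p) \<le> 1 * 1"
      by (intro mult_mono) (auto simp: pos_sq_def)
    then show ?thesis by (simp add: cutoff'_def)
  qed (simp add: cutoff_le_0)
qed

lemma cutoff_mono: "p \<le> q \<Longrightarrow> cutoff p \<le> cutoff q"
  by (rule DERIV_nonneg_imp_nondecreasing) (auto intro: DERIV_cutoff cutoff'_bounds)

lemma cutoff_bounds: "0 \<le> cutoff p" "cutoff p \<le> 1"
  using cutoff_mono[of p "max 1 p"] by (auto simp: cutoff_def pos_sq_def cutoff_ge_1)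

section \<open>Integrals over Euclidean space\<close>

lemma lipschitz_if_bounded_DERIV_off_finite:
  fixes g :: "real \<Rightarrow> real"
  assumes "finite K" and cont: "continuous_on UNIV g"
    and der: "\<And>s. s \<notin> K \<Longrightarrow> (g has_real_derivative g' s) (at s)"
    and bnd: "\<And>s. s \<notin> K \<Longrightarrow> \<bar>g' s\<bar> \<le> M" and M: "0 \<le> M"
  shows "\<bar>g t - g s\<bar> \<le> M * \<bar>t - s\<bar>"
proof -
  have *: "\<bar>g b - g a\<bar> \<le> M * (b - a)" if "a \<le> b" for a b
  proof -
    have "(g' has_integral (g b - g a)) {a..b}"
      by (rule fundamental_theorem_of_calculus_strong[OF \<open>finite K\<close> that])
        (auto intro: der continuous_on_subset[OF cont] simp flip: has_real_derivative_iff_has_vector_derivative)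
    then have "norm (g b - g a) \<le> M * measure lborel (cbox a b)"
      by (intro has_integral_bound_spike_finite[OF M \<open>finite K\<close>]) (auto intro: bnd)
    then show ?thesis using that by simp
  qed
  show ?thesis using *[of s t] *[of t s] by (cases "s \<le> t") auto
qed

lemma integral_lborel_translate:
  fixes f :: "'a::euclidean_space \<Rightarrow> real"
  assumes [measurable]: "f \<in> borel_measurable borel"
  shows "(\<integral>x. f (c + x) \<partial>lborel) = (\<integral>x. f x \<partial>lborel)"
    and "integrable lborel f \<Longrightarrow> integrable lborel (\<lambda>x. f (c + x))"
proof -
  have "(\<integral>x. f x \<partial>distr lborel borel ((+) c)) = (\<integral>x. f (c + x) \<partial>lborel)"
    by (rule integral_distr) auto
  then show "(\<integral>x. f (c + x) \<partial>lborel) = (\<integral>x. f x \<partial>lborel)" by (simp add: lborel_distr_plus)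
  have "integrable (distr lborel borel ((+) c)) f \<longleftrightarrow> integrable lborel (\<lambda>x. f (c + x))"
    by (rule integrable_distr_eq) auto
  then show "integrable lborel f \<Longrightarrow> integrable lborel (\<lambda>x. f (c + x))" by (simp add: lborel_distr_plus)
qed

lemma nn_integral_lborel_translate:
  fixes f :: "'a::euclidean_space \<Rightarrow> ennreal"
  assumes [measurable]: "f \<in> borel_measurable borel"
  shows "(\<integral>\<^sup>+x. f (c + x) \<partial>lborel) = (\<integral>\<^sup>+x. f x \<partial>lborel)"
proof -
  have "(\<integral>\<^sup>+x. f x \<partial>distr lborel borel ((+) c)) = (\<integral>\<^sup>+x. f (c + x) \<partial>lborel)"
    by (rule nn_integral_distr) auto
  then show ?thesis by (simp add: lborel_distr_plus)
qed

lemma integrable_bounded_support: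
  fixes f :: "'a::euclidean_space \<Rightarrow> real"
  assumes "f \<in> borel_measurable borel" "bounded S" "\<And>x. x \<notin> S \<Longrightarrow> f x = 0"
    and "\<And>x. \<bar>f x\<bar> \<le> M"
  shows "integrable lborel f"
proof -
  obtain r where r: "S \<subseteq> cball 0 r" using \<open>bounded S\<close> unfolding bounded_iff subset_iff mem_cball_0 by metis
  have "integrable lborel (\<lambda>x::'a. M * indicator (cball 0 r) x)"
    by (intro integrable_mult_right integrable_real_indicator) (simp_all add: emeasure_bounded_finite[simplified])
  then show ?thesis
  proof (rule Bochner_Integration.integrable_bound)
    have "0 \<le> M" using assms(4)[of undefined] by linarith
    then show "AE x in lborel. norm (f x) \<le> norm (M * indicator (cball 0 r) x)"
      using assms(3,4) r by (intro AE_I2) (force simp: indicator_def)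
  qed (use assms(1) in simp)
qed

lemma fst_snd_borel [measurable]:
  "(fst :: 'a::topological_space \<times> 'b::topological_space \<Rightarrow> 'a) \<in> borel_measurable borel"
  "(snd :: 'a::topological_space \<times> 'b::topological_space \<Rightarrow> 'b) \<in> borel_measurable borel"
  by (intro borel_measurable_continuous_onI continuous_intros)+

lemma hyperplane_null: "{X :: 'a::euclidean_space \<times> real. snd X = c} \<in> null_sets lborel"
proof -
  have "closed {X :: 'a::euclidean_space \<times> real. snd X = c}" by (intro closed_Collect_eq continuous_intros)
  then have "{X :: 'a::euclidean_space \<times> real. snd X = c} \<in> sets lborel" by simp
  moreover have "negligible {X :: 'a::euclidean_space \<times> real. X \<bullet> (0, 1) = c}"
    by (rule negligible_standard_hyperplane) (simp add: Basis_prod_def)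
  ultimately show ?thesis
    by (simp add: negligible_iff_null_sets null_sets_completion_iff inner_prod_def)
qed

lemma integral_lborel_slab:
  fixes g :: "'a::euclidean_space \<Rightarrow> real"
  assumes [measurable]: "g \<in> borel_measurable borel"
    and "bounded S" and "\<And>x. x \<notin> S \<Longrightarrow> g x = 0" and "\<And>x. \<bar>g x\<bar> \<le> M" and "\<alpha> \<le> \<beta>"
  shows "integrable lborel (\<lambda>X. indicator {\<alpha><..\<beta>} (snd X) * g (fst X))"
    and "(\<integral>X. indicator {\<alpha><..\<beta>} (snd X) * g (fst X) \<partial>lborel) = (\<beta> - \<alpha>) * (\<integral>x. g x \<partial>lborel)"
proof -
  let ?f = "\<lambda>X :: 'a \<times> real. indicator {\<alpha><..\<beta>} (snd X) * g (fst X)"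
  show int: "integrable lborel ?f"
  proof (rule integrable_bounded_support[where S="S \<times> {\<alpha>..\<beta>}" and M="M"])
    have [measurable]: "(\<lambda>X :: 'a \<times> real. g (fst X)) \<in> borel_measurable borel"
      "(\<lambda>X :: 'a \<times> real. indicator {\<alpha><..\<beta>} (snd X) :: real) \<in> borel_measurable borel"
      by (rule measurable_compose[OF _ assms(1)] measurable_compose[OF fst_snd_borel(2)]; simp)+
    show "?f \<in> borel_measurable borel" by measurable
    show "bounded (S \<times> {\<alpha>..\<beta>})" using assms(2) by (intro bounded_Times) auto
    show "?f X = 0" if "X \<notin> S \<times> {\<alpha>..\<beta>}" for X
      using that assms(3)[of "fst X"] by (cases X) (auto simp: indicator_def)
    show "\<bar>?f X\<bar> \<le> M" for X using assms(4)[of "fst X"] by (auto simp: indicator_def)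
  qed
  then have int': "integrable (lborel \<Otimes>\<^sub>M lborel) ?f" by (simp add: lborel_prod)
  have "(\<integral>X. ?f X \<partial>lborel) = (\<integral>x. \<integral>y. ?f (x, y) \<partial>lborel \<partial>lborel)"
    using lborel_pair.integral_fst'[OF int'] by (simp add: lborel_prod)
  also have "\<dots> = (\<beta> - \<alpha>) * (\<integral>x. g x \<partial>lborel)" using assms(5) by simp
  finally show "(\<integral>X. ?f X \<partial>lborel) = (\<beta> - \<alpha>) * (\<integral>x. g x \<partial>lborel)" .
qed

text \<open>
  Integration by parts without boundary: the integral of a difference quotient of \<open>H\<close> vanishes because
  Lebesgue measure is translation invariant, and dominated convergence carries this over to the
  derivative. Working with one direction at a time, directly in the full space, avoids iterated integrals
  and allows \<open>H\<close> to have kinks: \<open>H\<close> only has to be Lipschitz along lines in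
  direction \<open>b\<close>, which follows from continuity and a bounded derivative off finitely many
  points of each line.
\<close>

lemma integral_directional_derivative_eq_0:
  fixes H D :: "'a::euclidean_space \<Rightarrow> real"
  assumes cont: "continuous_on UNIV H" and S: "bounded S" "\<And>X. X \<notin> S \<Longrightarrow> H X = 0"
    and D [measurable]: "D \<in> borel_measurable borel"
    and N: "N \<in> null_sets lborel" "\<And>X. finite {s. X + s *\<^sub>R b \<in> N}"
    and der: "\<And>X. X \<notin> N \<Longrightarrow> ((\<lambda>s. H (X + s *\<^sub>R b)) has_real_derivative D X) (at 0)"
    and bnd: "\<And>X. X \<notin> N \<Longrightarrow> \<bar>D X\<bar> \<le> M" and M: "0 \<le> M"
  shows "integrable lborel D" "(\<integral>X. D X \<partial>lborel) = 0"
proof -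
  note [measurable] = borel_measurable_continuous_onI[OF cont]
  have lip: "\<bar>H (X + t *\<^sub>R b) - H X\<bar> \<le> M * \<bar>t\<bar>" for X t
  proof -
    have d: "((\<lambda>s. H (X + s *\<^sub>R b)) has_real_derivative D (X + s *\<^sub>R b)) (at s)"
      if "s \<notin> {s. X + s *\<^sub>R b \<in> N}" for s
    proof -
      have "((\<lambda>r. H ((X + s *\<^sub>R b) + r *\<^sub>R b)) has_real_derivative D (X + s *\<^sub>R b)) (at 0)"
        using that by (intro der) auto
      then have "((\<lambda>r. H (X + (r + s) *\<^sub>R b)) has_real_derivative D (X + s *\<^sub>R b)) (at 0)"
        by (simp add: algebra_simps)
      then show ?thesis
        using DERIV_shift[of "\<lambda>s. H (X + s *\<^sub>R b)" "D (X + s *\<^sub>R b)" 0 s] by simp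
    qed
    have "\<bar>H (X + t *\<^sub>R b) - H (X + 0 *\<^sub>R b)\<bar> \<le> M * \<bar>t - 0\<bar>"
      by (rule lipschitz_if_bounded_DERIV_off_finite[OF N(2)[of X] _ d _ M])
        (auto intro!: bnd continuous_on_compose2[OF cont] continuous_intros)
    then show ?thesis by simp
  qed
  obtain r where r: "S \<subseteq> cball 0 r" using S(1) unfolding bounded_iff subset_iff mem_cball_0 by metis
  define h where "h n = 1 / real (Suc n)" for n
  have h: "h n > 0" "h n \<le> 1" for n by (auto simp: h_def)
  define q where "q n X = (H (X + h n *\<^sub>R b) - H X) / h n" for n X
  define W where "W X = M * indicator (cball 0 (r + norm b)) X" for X :: 'a
  have q [measurable]: "q n \<in> borel_measurable borel" for n unfolding q_def by measurable
  have W: "integrable lborel W" unfolding W_def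
    by (intro integrable_mult_right integrable_real_indicator) (simp_all add: emeasure_bounded_finite[simplified])
  have lim: "AE X in lborel. (\<lambda>n. q n X) \<longlonglongrightarrow> D X"
  proof (rule AE_I'[OF N(1)], safe)
    fix X assume a: "\<not> (\<lambda>n. q n X) \<longlonglongrightarrow> D X"
    show "X \<in> N"
    proof (rule ccontr)
      assume "X \<notin> N"
      from der[OF this] have "((\<lambda>s. (H (X + s *\<^sub>R b) - H X) / s) \<longlongrightarrow> D X) (at 0)"
        by (simp add: DERIV_def)
      moreover have "filterlim h (at 0) sequentially"
        using h LIMSEQ_inverse_real_of_nat
        by (auto simp: filterlim_at h_def[abs_def] inverse_eq_divide intro!: eventuallyI)
      ultimately have "(\<lambda>n. q n X) \<longlonglongrightarrow> D X"
        unfolding q_def by (rule filterlim_compose)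
      with a show False by simp
    qed
  qed
  have bound: "AE X in lborel. norm (q n X) \<le> W X" for n
  proof (rule AE_I2)
    fix X
    show "norm (q n X) \<le> W X"
    proof (cases "X \<in> cball 0 (r + norm b)")
      case True
      have "\<bar>H (X + h n *\<^sub>R b) - H X\<bar> \<le> M * h n" using lip[of X "h n"] h[of n] by simp
      then show ?thesis using True h[of n] by (simp add: q_def W_def field_simps)
    next
      case False
      have "h n * norm b \<le> norm b" using h[of n] mult_right_mono[of "h n" 1 "norm b"] by simp
      then have "norm (h n *\<^sub>R b) \<le> norm b" using h[of n] by simp
      then have "\<not> norm (X + h n *\<^sub>R b) \<le> r" using norm_triangle_ineq4[of "X + h n *\<^sub>R b" "h n *\<^sub>R b"] False
        by auto
      moreover have "\<not> norm X \<le> r" using False norm_ge_zero[of b] by (auto simp del: norm_ge_zero)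
      ultimately have "X + h n *\<^sub>R b \<notin> S" "X \<notin> S" using r by auto
      then show ?thesis using S(2) False by (simp add: q_def W_def)
    qed
  qed
  show "integrable lborel D"
    by (rule integrable_dominated_convergence[OF _ _ W lim bound]) auto
  have "(\<lambda>n. integral\<^sup>L lborel (q n)) \<longlonglongrightarrow> integral\<^sup>L lborel D"
    by (rule integral_dominated_convergence[OF _ _ W lim bound]) auto
  moreover have "integral\<^sup>L lborel (q n) = 0" for n
  proof -
    have cb: "compact (cball (0::'a) r)" by simp
    have "compact (H ` cball 0 r)"
      by (rule compact_continuous_image) (auto intro: continuous_on_subset[OF cont])
    then obtain B where B: "\<And>X. X \<in> cball 0 r \<Longrightarrow> \<bar>H X\<bar> \<le> B"
      using compact_imp_bounded bounded_iff by (metis imageI real_norm_def)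
    have "\<bar>H X\<bar> \<le> max B 0" for X
      using B[of X] S(2)[of X] r by (cases "X \<in> S") (auto simp: max_def subset_iff)
    then have "integrable lborel H"
      by (intro integrable_bounded_support[OF _ S]) auto
    then show ?thesis
      using integral_lborel_translate[of H "h n *\<^sub>R b"] by (simp add: q_def [abs_def] add.commute)
  qed
  ultimately show "(\<integral>X. D X \<partial>lborel) = 0" by (simp add: LIMSEQ_const_iff)
qed


section \<open>Quadratic forms and directional derivatives\<close>

definition form :: "real ^ 'm ^ 'm \<Rightarrow> real ^ 'm \<Rightarrow> real ^ 'm \<Rightarrow> real"
  where "form M \<xi> \<zeta> = \<xi> \<bullet> (M *v \<zeta>)"

lemma form_eq_sum: "form M \<xi> \<zeta> = (\<Sum>i\<in>UNIV. \<Sum>j\<in>UNIV. M $ i $ j * \<xi> $ i * \<zeta> $ j)"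
  by (simp add: form_def inner_vec_def matrix_vector_mult_def sum_distrib_left mult_ac)

lemma form_add_left: "form M (\<xi> + \<xi>') \<zeta> = form M \<xi> \<zeta> + form M \<xi>' \<zeta>"
  and form_diff_left: "form M (\<xi> - \<xi>') \<zeta> = form M \<xi> \<zeta> - form M \<xi>' \<zeta>"
  and form_add_right: "form M \<zeta> (\<xi> + \<xi>') = form M \<zeta> \<xi> + form M \<zeta> \<xi>'"
  and form_diff_right: "form M \<zeta> (\<xi> - \<xi>') = form M \<zeta> \<xi> - form M \<zeta> \<xi>'"
  and form_scaleR_left: "form M (c *\<^sub>R \<xi>) \<zeta> = c * form M \<xi> \<zeta>"
  and form_scaleR_right: "form M \<zeta> (c *\<^sub>R \<xi>) = c * form M \<zeta> \<xi>"
  by (simp_all add: form_def inner_add_left inner_diff_left inner_add_right inner_diff_right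
      matrix_vector_right_distrib matrix_vector_mult_diff_distrib matrix_vector_mult_scaleR)

lemma form_zero [simp]: "form M 0 \<zeta> = 0" "form M \<zeta> 0 = 0"
  by (simp_all add: form_def)

lemma form_commute: "transpose M = M \<Longrightarrow> form M \<xi> \<zeta> = form M \<zeta> \<xi>"
  by (metis form_def inner_commute dot_lmul_matrix vector_transpose_matrix)

text \<open>
  The polarisation identity behind the whole argument: it turns the tested equation into a balance of
  energies.
\<close>

lemma form_diff_self:
  assumes "transpose M = M"
  shows "2 * form M (p - r) p = form M p p + form M (p - r) (p - r) - form M r r"
  using form_commute[OF assms, of p r] by (simp add: form_diff_left form_diff_right)

text \<open>
  Both signs of \<open>\<xi> \<plusminus> c \<zeta>\<close> are inserted into the form, which is nonnegative.
\<close>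

lemma form_young:
  assumes sym: "transpose M = M" and psd: "\<And>\<xi>. 0 \<le> form M \<xi> \<xi>" and "c > 0"
  shows "\<bar>2 * form M \<xi> \<zeta>\<bar> \<le> form M \<xi> \<xi> / c + c * form M \<zeta> \<zeta>"
proof -
  have "0 \<le> form M (\<xi> + s *\<^sub>R \<zeta>) (\<xi> + s *\<^sub>R \<zeta>)" for s by (rule psd)
  then have *: "0 \<le> form M \<xi> \<xi> + 2 * s * form M \<xi> \<zeta> + s * s * form M \<zeta> \<zeta>" for s
    using form_commute[OF sym, of \<xi> \<zeta>]
    by (simp add: form_add_left form_add_right form_scaleR_left form_scaleR_right algebra_simps)
  have "0 \<le> (form M \<xi> \<xi> + 2 * c * form M \<xi> \<zeta> + c * c * form M \<zeta> \<zeta>) / c"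
    "0 \<le> (form M \<xi> \<xi> + 2 * (-c) * form M \<xi> \<zeta> + (-c) * (-c) * form M \<zeta> \<zeta>) / c"
    using *[of c] *[of "-c"] \<open>c > 0\<close> by (auto intro!: divide_nonneg_pos)
  then show ?thesis using \<open>c > 0\<close> by (simp add: add_divide_distrib diff_divide_distrib abs_le_iff)
qed

lemma norm_diff_sq_bound:
  fixes p r :: "'a::real_inner" shows "(norm p)\<^sup>2 \<le> 2 * (norm (p - r))\<^sup>2 + 2 * (norm r)\<^sup>2"
proof -
  have "0 \<le> (norm (p - 2 *\<^sub>R r))\<^sup>2" by simp
  then show ?thesis
    unfolding power2_norm_eq_inner
    by (simp add: inner_diff_left inner_diff_right inner_commute)
qed

lemma norm_sq_eq_sum: "(norm (\<xi> :: real ^ 'm))\<^sup>2 = (\<Sum>i\<in>UNIV. (\<xi> $ i)\<^sup>2)"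
  by (simp add: norm_vec_def L2_set_def sum_nonneg)

lemma sum_UNIV_option: "(\<Sum>i\<in>UNIV. f i) = f None + (\<Sum>k\<in>(UNIV :: 'm::finite set). f (Some k))"
  by (simp add: UNIV_option_conv sum.reindex)

lemma DERIV_transform_eventually:
  assumes "(f has_real_derivative d) (at 0)" "eventually (\<lambda>s. f s = g s) (at 0)" "f 0 = g 0"
  shows "(g has_real_derivative d) (at 0)"
proof -
  have "eventually (\<lambda>s. f s = g s) (nhds 0)"
    using assms(2,3) by (auto simp: eventually_at_filter elim: eventually_mono)
  then show ?thesis using assms(1) DERIV_cong_ev[of 0 0 f g d d] by simp
qed

lemma line_derivative:
  assumes "H differentiable (at X)"
  shows "((\<lambda>s. H (X + s *\<^sub>R coord_dir i)) has_real_derivative partial_deriv i H X) (at 0)"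
proof -
  define D where "D = frechet_derivative H (at X)"
  have D: "(H has_derivative D) (at (X + 0 *\<^sub>R coord_dir i))"
    using assms by (simp add: D_def frechet_derivative_works)
  have "((\<lambda>s. X + s *\<^sub>R coord_dir i) has_derivative (\<lambda>s. s *\<^sub>R coord_dir i)) (at 0)"
    by (auto intro!: derivative_eq_intros)
  from has_derivative_compose[OF this D]
  have "((\<lambda>s. H (X + s *\<^sub>R coord_dir i)) has_derivative (\<lambda>s. D (s *\<^sub>R coord_dir i))) (at 0)" .
  moreover have "D (s *\<^sub>R coord_dir i) = s * D (coord_dir i)" for s
    using D has_derivative_linear linear_scale by fastforce
  ultimately show ?thesis
    by (simp add: has_field_derivative_def partial_deriv_def D_def mult.commute[of _ "frechet_derivative H (at X) (coord_dir i)"])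
qed

lemma partial_deriv_eqI: "(H has_derivative D) (at X) \<Longrightarrow> partial_deriv i H X = D (coord_dir i)"
  by (simp add: partial_deriv_def frechet_derivative_at[symmetric])

lemma has_derivative_partial_deriv:
  "H differentiable (at X) \<Longrightarrow> (H has_derivative frechet_derivative H (at X)) (at X)"
  by (simp add: frechet_derivative_works)

lemma partial_deriv_matrix_mult:
  assumes u: "\<And>j. partial_deriv j u differentiable (at X)"
    and A: "\<And>j. (\<lambda>Y. A Y $ i $ j) differentiable (at X)"
  shows "(\<lambda>Y. (A Y *v grad u Y) $ i) differentiable (at X)"
    and "partial_deriv k (\<lambda>Y. (A Y *v grad u Y) $ i) X =
      (\<Sum>j\<in>UNIV. A X $ i $ j * partial_deriv k (partial_deriv j u) X
        + partial_deriv k (\<lambda>Y. A Y $ i $ j) X * partial_deriv j u X)"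
proof -
  have eq: "(\<lambda>Y. (A Y *v grad u Y) $ i) = (\<lambda>Y. \<Sum>j\<in>UNIV. A Y $ i $ j * partial_deriv j u Y)"
    by (simp add: matrix_vector_mult_def grad_def)
  have *: "((\<lambda>Y. (A Y *v grad u Y) $ i) has_derivative
     (\<lambda>h. \<Sum>j\<in>UNIV. A X $ i $ j * frechet_derivative (partial_deriv j u) (at X) h
        + frechet_derivative (\<lambda>Y. A Y $ i $ j) (at X) h * partial_deriv j u X)) (at X)"
    unfolding eq
    by (intro has_derivative_sum has_derivative_mult has_derivative_partial_deriv u A)
  show "(\<lambda>Y. (A Y *v grad u Y) $ i) differentiable (at X)"
    using * differentiable_def by blast
  show "partial_deriv k (\<lambda>Y. (A Y *v grad u Y) $ i) X =
      (\<Sum>j\<in>UNIV. A X $ i $ j * partial_deriv k (partial_deriv j u) X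
        + partial_deriv k (\<lambda>Y. A Y $ i $ j) X * partial_deriv j u X)"
    using partial_deriv_eqI[OF *, of k] unfolding partial_deriv_def[of k] .
qed

lemma Ck_on_imp_continuous_on: "Ck_on k S u \<Longrightarrow> continuous_on S u"
  by (cases k) (auto intro!: differentiable_imp_continuous_on continuous_at_imp_continuous_on
      differentiable_imp_continuous_within)

section \<open>The cutoff function of a cylinder\<close>

definition radial_arg :: "real ^ 'n::finite \<Rightarrow> real \<Rightarrow> real ^ 'n \<Rightarrow> real"
  where "radial_arg x\<^sub>0 R x = (4 - (norm (x - x\<^sub>0))\<^sup>2 / R\<^sup>2) / 3"

definition height_arg :: "real \<Rightarrow> real \<Rightarrow> real"
  where "height_arg R t = (2 * R - t) / (R - 2)"

text \<open>
  \<open>radial_arg\<close> falls from $1$ to $0$ as $|x - x_0|$ grows from $R$ to $2R$; the square of the norm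
  keeps it smooth at $x_0$. \<open>height_arg\<close> falls from $1$ to $0$ as $t$ grows from $R + 2$ to $2R$:
  the plateau extends beyond $R + 1$ in order that a point where the gradient of the cutoff is not zero
  stays outside $T(x_0,R)$ when it is lowered by one period.
\<close>

definition cyl_cutoff :: "real ^ 'n::finite \<Rightarrow> real \<Rightarrow> (real ^ 'n) \<times> real \<Rightarrow> real"
  where "cyl_cutoff x\<^sub>0 R X = cutoff (radial_arg x\<^sub>0 R (fst X)) * cutoff (height_arg R (snd X))"

definition cyl_cutoff_grad :: "real ^ 'n::finite \<Rightarrow> real \<Rightarrow> (real ^ 'n) \<times> real \<Rightarrow> real ^ 'n option"
  where "cyl_cutoff_grad x\<^sub>0 R X = (\<chi> i. case i of
      None \<Rightarrow> cutoff (radial_arg x\<^sub>0 R (fst X)) * (cutoff' (height_arg R (snd X)) * (- 1 / (R - 2)))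
    | Some k \<Rightarrow> cutoff' (radial_arg x\<^sub>0 R (fst X)) * (- 2 * ((fst X - x\<^sub>0) $ k) / (3 * R\<^sup>2))
        * cutoff (height_arg R (snd X)))"

context
  fixes x\<^sub>0 :: "real ^ 'n::finite" and R :: real
  assumes R: "R > 10"
begin

lemma cyl_cutoff_line_derivative:
  "((\<lambda>s. cyl_cutoff x\<^sub>0 R (X + s *\<^sub>R coord_dir i)) has_real_derivative cyl_cutoff_grad x\<^sub>0 R X $ i) (at 0)"
proof (cases i)
  case None
  have "((\<lambda>s. height_arg R (snd X + s)) has_real_derivative - 1 / (R - 2)) (at 0)"
  proof -
    have "((\<lambda>s. 2 * R - (snd X + s)) has_real_derivative - 1) (at 0)"
      by (auto intro!: derivative_eq_intros)
    then show ?thesis unfolding height_arg_def by (rule DERIV_cdivide)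
  qed
  then have "((\<lambda>s. cutoff (height_arg R (snd X + s))) has_real_derivative
      cutoff' (height_arg R (snd X)) * (- 1 / (R - 2))) (at 0)"
    using DERIV_chain2[OF DERIV_cutoff] by fastforce
  then show ?thesis using DERIV_cmult None
    by (fastforce simp: cyl_cutoff_def cyl_cutoff_grad_def)
next
  case (Some k)
  have "((\<lambda>s. (norm (fst X + s *\<^sub>R axis k 1 - x\<^sub>0))\<^sup>2) has_real_derivative 2 * ((fst X - x\<^sub>0) $ k)) (at 0)"
  proof -
    have "(norm (fst X + s *\<^sub>R axis k 1 - x\<^sub>0))\<^sup>2
        = (norm (fst X - x\<^sub>0))\<^sup>2 + 2 * s * ((fst X - x\<^sub>0) $ k) + s\<^sup>2" for s
    proof -
      define y where "y = fst X - x\<^sub>0"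
      have e: "fst X + s *\<^sub>R axis k 1 - x\<^sub>0 = y + s *\<^sub>R axis k 1" by (simp add: y_def)
      show ?thesis
        unfolding e y_def[symmetric] power2_norm_eq_inner
        by (simp add: inner_add_left inner_add_right inner_axis inner_axis' power2_eq_square distrib_left)
    qed
    then show ?thesis by (auto intro!: derivative_eq_intros)
  qed
  then have "((\<lambda>s. radial_arg x\<^sub>0 R (fst X + s *\<^sub>R axis k 1)) has_real_derivative
      - 2 * ((fst X - x\<^sub>0) $ k) / (3 * R\<^sup>2)) (at 0)"
    unfolding radial_arg_def
    by (rule DERIV_cong[OF DERIV_cdivide[OF DERIV_diff[OF DERIV_const DERIV_cdivide]]])
      (use R in \<open>auto simp: field_simps\<close>)
  then have "((\<lambda>s. cutoff (radial_arg x\<^sub>0 R (fst X + s *\<^sub>R axis k 1))) has_real_derivative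
      cutoff' (radial_arg x\<^sub>0 R (fst X)) * (- 2 * ((fst X - x\<^sub>0) $ k) / (3 * R\<^sup>2))) (at 0)"
    using DERIV_chain2[OF DERIV_cutoff] by fastforce
  from DERIV_cmult_right[OF this, of "cutoff (height_arg R (snd X))"] show ?thesis
    using Some by (simp add: cyl_cutoff_def cyl_cutoff_grad_def)
qed

lemma continuous_cyl_cutoff: "continuous_on UNIV (cyl_cutoff x\<^sub>0 R)"
proof -
  have c: "continuous_on UNIV cutoff"
    using DERIV_cutoff DERIV_continuous continuous_at_imp_continuous_on by blast
  show ?thesis unfolding cyl_cutoff_def radial_arg_def height_arg_def using R
    by (intro continuous_intros continuous_on_compose2[OF c]) auto
qed

lemma continuous_cyl_cutoff_grad: "continuous_on UNIV (\<lambda>X. cyl_cutoff_grad x\<^sub>0 R X $ i)"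
proof -
  have c: "continuous_on UNIV cutoff"
    using DERIV_cutoff DERIV_continuous continuous_at_imp_continuous_on by blast
  show ?thesis unfolding cyl_cutoff_grad_def radial_arg_def height_arg_def using R
    by (cases i; simp) (intro continuous_intros continuous_on_compose2[OF c]
        continuous_on_compose2[OF continuous_cutoff']; auto)+
qed

lemma cyl_cutoff_bounds: "0 \<le> cyl_cutoff x\<^sub>0 R X" "cyl_cutoff x\<^sub>0 R X \<le> 1"
  unfolding cyl_cutoff_def by (auto intro!: mult_nonneg_nonneg mult_le_one cutoff_bounds)

lemma radial_arg_le_0: "x \<notin> ball x\<^sub>0 (2 * R) \<Longrightarrow> radial_arg x\<^sub>0 R x \<le> 0"
proof -
  assume "x \<notin> ball x\<^sub>0 (2 * R)"
  then have "(2 * R)\<^sup>2 \<le> (norm (x - x\<^sub>0))\<^sup>2"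
    using R by (intro power_mono) (auto simp: dist_norm norm_minus_commute)
  then show ?thesis using R by (simp add: radial_arg_def field_simps)
qed

lemma radial_arg_ge_1: "x \<in> cball x\<^sub>0 R \<Longrightarrow> radial_arg x\<^sub>0 R x \<ge> 1"
proof -
  assume "x \<in> cball x\<^sub>0 R"
  then have "(norm (x - x\<^sub>0))\<^sup>2 \<le> R\<^sup>2"
    using R by (intro power_mono) (auto simp: dist_norm norm_minus_commute)
  then show ?thesis using R by (simp add: radial_arg_def field_simps)
qed

lemma cyl_cutoff_eq_0:
  assumes "x \<notin> ball x\<^sub>0 (2 * R) \<or> t \<ge> 2 * R"
  shows "cyl_cutoff x\<^sub>0 R (x, t) = 0" "cyl_cutoff_grad x\<^sub>0 R (x, t) = 0"
proof -
  have "radial_arg x\<^sub>0 R x \<le> 0 \<or> height_arg R t \<le> 0"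
    using assms radial_arg_le_0 R by (auto simp: height_arg_def divide_nonpos_pos)
  then show "cyl_cutoff x\<^sub>0 R (x, t) = 0" "cyl_cutoff_grad x\<^sub>0 R (x, t) = 0"
    by (auto simp: cyl_cutoff_def cyl_cutoff_grad_def cutoff_le_0 vec_eq_iff split: option.split)
qed

lemma cyl_cutoff_plateau:
  assumes "x \<in> cball x\<^sub>0 R" "t \<le> R + 2"
  shows "cyl_cutoff x\<^sub>0 R (x, t) = 1" "cyl_cutoff_grad x\<^sub>0 R (x, t) = 0"
proof -
  have "radial_arg x\<^sub>0 R x \<ge> 1" "height_arg R t \<ge> 1"
    using assms radial_arg_ge_1 R by (auto simp: height_arg_def)
  then show "cyl_cutoff x\<^sub>0 R (x, t) = 1" "cyl_cutoff_grad x\<^sub>0 R (x, t) = 0"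
    by (auto simp: cyl_cutoff_def cyl_cutoff_grad_def cutoff_ge_1 vec_eq_iff split: option.split)
qed

text \<open>
  This monotonicity gives the remainder of the translation by one period its sign.
\<close>

lemma cyl_cutoff_antimono: "s \<le> t \<Longrightarrow> cyl_cutoff x\<^sub>0 R (x, t) \<le> cyl_cutoff x\<^sub>0 R (x, s)"
  unfolding cyl_cutoff_def height_arg_def using R
  by (auto intro!: mult_left_mono cutoff_mono cutoff_bounds divide_right_mono)

text \<open>
  The factor $R - 2$ in the derivative in $t$ is at least $4R/5$, because $R > 10$; this contributes $25/R^2$, and
  the derivatives in $x$ contribute at most $256/(9R^2)$.
\<close>

lemma norm_cyl_cutoff_grad: "(norm (cyl_cutoff_grad x\<^sub>0 R X))\<^sup>2 \<le> 64 / R\<^sup>2"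
proof (cases "fst X \<in> ball x\<^sub>0 (2 * R)")
  case True
  define c where "c = cutoff' (radial_arg x\<^sub>0 R (fst X)) * cutoff (height_arg R (snd X))"
  define d where "d = cutoff (radial_arg x\<^sub>0 R (fst X)) * cutoff' (height_arg R (snd X))"
  define z where "z = fst X - x\<^sub>0"
  have c: "0 \<le> c" "c \<le> 4 * 1" unfolding c_def
    by (intro mult_nonneg_nonneg cutoff_bounds cutoff'_bounds mult_mono; simp)+
  have d: "0 \<le> d" "d \<le> 1 * 4" unfolding d_def
    by (intro mult_nonneg_nonneg cutoff_bounds cutoff'_bounds mult_mono; simp)+
  have c2: "c\<^sup>2 \<le> 4\<^sup>2" and d2: "d\<^sup>2 \<le> 4\<^sup>2" using c d by (intro power_mono; simp)+
  have "(norm (cyl_cutoff_grad x\<^sub>0 R X))\<^sup>2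
      = (d / (R - 2))\<^sup>2 + (\<Sum>k\<in>UNIV. (2 * c / (3 * R\<^sup>2))\<^sup>2 * (z $ k)\<^sup>2)"
    unfolding norm_sq_eq_sum sum_UNIV_option cyl_cutoff_grad_def c_def d_def z_def[symmetric]
    by (simp add: power_mult_distrib power_divide mult_ac)
  also have "\<dots> = d\<^sup>2 / (R - 2)\<^sup>2 + 4 * c\<^sup>2 / (9 * R^4) * (norm z)\<^sup>2"
    by (simp add: norm_sq_eq_sum sum_distrib_left power_mult_distrib power_divide flip: power_mult)
  also have "\<dots> \<le> 4\<^sup>2 / (4 / 5 * R)\<^sup>2 + 4 * 4\<^sup>2 / (9 * R^4) * (2 * R)\<^sup>2"
  proof (intro add_mono mult_mono divide_right_mono frac_le mult_left_mono c2 d2)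
    show "(4 / 5 * R)\<^sup>2 \<le> (R - 2)\<^sup>2" using R by (intro power_mono) auto
    show "(norm z)\<^sup>2 \<le> (2 * R)\<^sup>2"
      using True by (intro power_mono) (auto simp: z_def dist_norm norm_minus_commute)
  qed (use R in auto)
  also have "\<dots> \<le> 64 / R\<^sup>2"
    using R by (simp add: field_simps power2_eq_square power4_eq_xxxx)
  finally show ?thesis .
next
  case False
  then have "cyl_cutoff_grad x\<^sub>0 R X = 0" using cyl_cutoff_eq_0[of "fst X" "snd X"] by simp
  then show ?thesis by simp
qed

end


section \<open>The tested equation\<close>

locale cylinder_solution =
  fixes \<mu> :: real
    and A :: "(real ^ 'n::finite) \<times> real \<Rightarrow> real ^ 'n option ^ 'n option"
    and x\<^sub>0 :: "real ^ 'n" and R :: real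
    and u :: "(real ^ 'n) \<times> real \<Rightarrow> real"
  assumes \<mu>_pos: "0 < \<mu>"
    and smooth: "smooth_matrix A"
    and symmetric: "\<And>X. transpose (A X) = A X"
    and elliptic: "elliptic_matrix \<mu> A"
    and periodic: "\<And>x t. A (x, t + 1) = A (x, t)"
    and R: "R > 10"
    and C2: "Ck_on 2 (cyl x\<^sub>0 (3 * R)) u"
    and solution: "\<And>X. X \<in> cyl x\<^sub>0 (3 * R) \<Longrightarrow> elliptic_op A u X = 0"
begin

abbreviation "T \<equiv> cyl x\<^sub>0 (3 * R)"
abbreviation "\<phi> \<equiv> cyl_cutoff x\<^sub>0 R"
abbreviation "\<phi>' \<equiv> cyl_cutoff_grad x\<^sub>0 R"

lemma open_T: "open T" by (simp add: cyl_def open_Times)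

text \<open>
  Extended by $0$, the gradient and the flux are Borel functions on the whole space and can be integrated there.
\<close>

definition gradu :: "(real ^ 'n) \<times> real \<Rightarrow> real ^ 'n option"
  where "gradu X = (if X \<in> T then grad u X else 0)"

definition flux :: "'n option \<Rightarrow> (real ^ 'n) \<times> real \<Rightarrow> real"
  where "flux i X = (if X \<in> T then (A X *v grad u X) $ i else 0)"

definition dflux :: "'n option \<Rightarrow> (real ^ 'n) \<times> real \<Rightarrow> real"
  where "dflux i X = (if X \<in> T then partial_deriv i (\<lambda>Y. (A Y *v grad u Y) $ i) X else 0)"

lemma u_differentiable: "X \<in> T \<Longrightarrow> u differentiable (at X)"
  and du_differentiable: "X \<in> T \<Longrightarrow> partial_deriv i u differentiable (at X)"
  and d2u_continuous: "continuous_on T (partial_deriv k (partial_deriv i u))"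
  and u_continuous: "continuous_on T u"
  and du_continuous: "continuous_on T (partial_deriv i u)"
proof -
  have *: "Ck_on (Suc (Suc 0)) T u" using C2 by (simp add: numeral_2_eq_2)
  show "X \<in> T \<Longrightarrow> u differentiable (at X)" "X \<in> T \<Longrightarrow> partial_deriv i u differentiable (at X)"
    "continuous_on T (partial_deriv k (partial_deriv i u))" using * by auto
  show "continuous_on T u" using * by (rule Ck_on_imp_continuous_on)
  show "continuous_on T (partial_deriv i u)" using * by (auto intro: Ck_on_imp_continuous_on[of "Suc 0"])
qed

lemma A_differentiable: "(\<lambda>Y. A Y $ i $ j) differentiable (at X)"
  and A_continuous: "continuous_on S (\<lambda>Y. A Y $ i $ j)"
  and dA_continuous: "continuous_on S (partial_deriv k (\<lambda>Y. A Y $ i $ j))"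
proof -
  have *: "Ck_on (Suc 0) UNIV (\<lambda>Y. A Y $ i $ j)" using smooth by (auto simp: smooth_matrix_def)
  show "(\<lambda>Y. A Y $ i $ j) differentiable (at X)"
    "continuous_on S (partial_deriv k (\<lambda>Y. A Y $ i $ j))"
    using * unfolding Ck_on.simps by (blast intro: continuous_on_subset)+
  show "continuous_on S (\<lambda>Y. A Y $ i $ j)" using Ck_on_imp_continuous_on[OF *] continuous_on_subset by blast
qed

lemma gradu_continuous: "continuous_on T (\<lambda>X. gradu X $ i)"
  using du_continuous[of i] by (rule continuous_on_eq) (simp add: gradu_def grad_def)

lemma flux_continuous: "continuous_on T (flux i)"
proof -
  have "continuous_on T (\<lambda>X. \<Sum>j\<in>UNIV. A X $ i $ j * partial_deriv j u X)"
    by (intro continuous_intros A_continuous du_continuous)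
  then show ?thesis
    by (rule continuous_on_eq) (simp add: flux_def matrix_vector_mult_def grad_def)
qed

lemma dflux_continuous: "continuous_on T (dflux i)"
proof -
  have "continuous_on T (\<lambda>X. \<Sum>j\<in>UNIV. A X $ i $ j * partial_deriv i (partial_deriv j u) X
        + partial_deriv i (\<lambda>Y. A Y $ i $ j) X * partial_deriv j u X)"
    by (intro continuous_intros A_continuous du_continuous dA_continuous d2u_continuous)
  then show ?thesis
    by (rule continuous_on_eq)
      (simp add: dflux_def partial_deriv_matrix_mult(2)[OF du_differentiable A_differentiable])
qed

lemma borel_if_T:
  fixes g :: "_ \<Rightarrow> real"
  assumes "continuous_on T g" "\<And>X. X \<notin> T \<Longrightarrow> g X = 0"
  shows "g \<in> borel_measurable borel"
proof -
  have "(\<lambda>X. if X \<in> T then g X else 0) \<in> borel_measurable borel"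
    using open_T by (intro borel_measurable_continuous_on_if assms(1)) auto
  moreover have "(\<lambda>X. if X \<in> T then g X else 0) = g" using assms(2) by auto
  ultimately show ?thesis by simp
qed

lemma gradu_measurable [measurable]: "(\<lambda>X. gradu X $ i) \<in> borel_measurable borel"
  by (rule borel_if_T[OF gradu_continuous]) (simp add: gradu_def)
lemma flux_measurable [measurable]: "flux i \<in> borel_measurable borel"
  by (rule borel_if_T[OF flux_continuous]) (simp add: flux_def)
lemma dflux_measurable [measurable]: "dflux i \<in> borel_measurable borel"
  by (rule borel_if_T[OF dflux_continuous]) (simp add: dflux_def)
lemma \<phi>_measurable [measurable]: "\<phi> \<in> borel_measurable borel"
  by (rule borel_measurable_continuous_onI[OF continuous_cyl_cutoff[OF R]])
lemma \<phi>'_measurable [measurable]: "(\<lambda>X. \<phi>' X $ i) \<in> borel_measurable borel"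
  by (rule borel_measurable_continuous_onI[OF continuous_cyl_cutoff_grad[OF R]])
lemma A_measurable [measurable]: "(\<lambda>X. A X $ i $ j) \<in> borel_measurable borel"
  by (rule borel_measurable_continuous_onI[OF A_continuous])

lemma line_eventually_T:
  assumes "X \<in> T" shows "eventually (\<lambda>s. X + s *\<^sub>R b \<in> T) (at 0)"
proof -
  have "((\<lambda>s. X + s *\<^sub>R b) \<longlongrightarrow> X + 0 *\<^sub>R b) (at 0)" by (intro tendsto_intros)
  then show ?thesis using topological_tendstoD[OF _ open_T] assms by simp
qed

lemma flux_line_derivative:
  assumes "X \<in> T"
  shows "((\<lambda>s. flux i (X + s *\<^sub>R coord_dir i)) has_real_derivative dflux i X) (at 0)"
proof (rule DERIV_transform_eventually)
  show "((\<lambda>s. (A (X + s *\<^sub>R coord_dir i) *v grad u (X + s *\<^sub>R coord_dir i)) $ i)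
      has_real_derivative dflux i X) (at 0)"
    using line_derivative[OF partial_deriv_matrix_mult(1)[OF du_differentiable[OF assms] A_differentiable], of i i]
      assms by (simp add: dflux_def)
qed (use line_eventually_T[OF assms, of "coord_dir i"] assms in \<open>auto simp: flux_def elim: eventually_mono\<close>)

end

text \<open>
  The height \<open>a\<close> plays the part of the boundary: the equation is tested in $\{t > a\}$, which keeps all
  second derivatives away from $t = 0$, where they need not be bounded.
\<close>

locale solution_above_height = cylinder_solution \<mu> A x\<^sub>0 R u
  for \<mu> :: real
    and A :: "(real ^ 'n::finite) \<times> real \<Rightarrow> real ^ 'n option ^ 'n option"
    and x\<^sub>0 :: "real ^ 'n" and R :: real
    and u :: "(real ^ 'n) \<times> real \<Rightarrow> real" +
  fixes a :: real
  assumes a: "0 < a" "a < 1"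
begin

text \<open>
  The gradient of $u(x,\max(t-1,a))$, that is, of what is subtracted from $u$ in \<open>lag_diff\<close>.
\<close>

definition lag_grad :: "(real ^ 'n) \<times> real \<Rightarrow> real ^ 'n option"
  where "lag_grad X = (\<chi> i. if 1 + a < snd X then gradu (fst X, snd X - 1) $ i
     else if i = None then 0 else gradu (fst X, a) $ i)"

text \<open>
  The first maximum makes the difference vanish for $t \le a$ too, so that it is continuous across $t = a$.
\<close>

definition lag_diff :: "(real ^ 'n) \<times> real \<Rightarrow> real"
  where "lag_diff X = (if X \<in> T then u (fst X, max (snd X) a) - u (fst X, max (snd X - 1) a) else 0)"

definition test_region :: "((real ^ 'n) \<times> real) set"
  where "test_region = cball x\<^sub>0 (2 * R) \<times> {a..2 * R}"

lemma compact_test_region: "compact test_region" by (simp add: test_region_def compact_Times)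

lemma test_region_subset_T: "test_region \<subseteq> T"
  using R a by (auto simp: test_region_def cyl_def)

lemma lag_diff_continuous: "continuous_on T lag_diff"
proof -
  have "continuous_on T (\<lambda>X. u (fst X, max (snd X) a) - u (fst X, max (snd X - 1) a))"
    using R a by (intro continuous_intros continuous_on_compose2[OF u_continuous]) (auto simp: cyl_def)
  then show ?thesis by (rule continuous_on_eq) (simp add: lag_diff_def)
qed

lemma lag_diff_measurable [measurable]: "lag_diff \<in> borel_measurable borel"
  by (rule borel_if_T[OF lag_diff_continuous]) (simp add: lag_diff_def)
lemma lag_grad_measurable [measurable]: "(\<lambda>X. lag_grad X $ i) \<in> borel_measurable borel"
proof -
  have [measurable]: "(\<lambda>X. gradu (fst X, snd X - 1) $ i) \<in> borel_measurable borel"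
    "(\<lambda>X. gradu (fst X, a) $ i) \<in> borel_measurable borel"
    by (rule measurable_compose[OF _ gradu_measurable];
        intro borel_measurable_continuous_onI continuous_intros)+
  show ?thesis unfolding lag_grad_def by simp
qed

lemma bounded_on_test_region:
  fixes g :: "_ \<Rightarrow> real"
  assumes "continuous_on T g"
  obtains B where "0 \<le> B" "\<And>X. X \<in> test_region \<Longrightarrow> \<bar>g X\<bar> \<le> B"
proof -
  have "compact (g ` test_region)"
    by (rule compact_continuous_image[OF continuous_on_subset[OF assms test_region_subset_T] compact_test_region])
  then obtain B where "\<And>X. X \<in> test_region \<Longrightarrow> \<bar>g X\<bar> \<le> B"
    using compact_imp_bounded bounded_iff by (metis imageI real_norm_def)
  then have "0 \<le> \<bar>B\<bar>" "\<And>X. X \<in> test_region \<Longrightarrow> \<bar>g X\<bar> \<le> \<bar>B\<bar>"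
    by (simp, meson abs_ge_self order_trans)
  then show thesis using that by blast
qed

lemma lag_diff_line_derivative:
  assumes X: "X \<in> T" "a < snd X" "i = None \<Longrightarrow> snd X \<noteq> 1 + a"
  shows "((\<lambda>s. lag_diff (X + s *\<^sub>R coord_dir i)) has_real_derivative (gradu X - lag_grad X) $ i) (at 0)"
proof (cases X)
  case (Pair x t)
  note t = X[unfolded Pair]
  have d1: "((\<lambda>s. u (X + s *\<^sub>R coord_dir i)) has_real_derivative gradu X $ i) (at 0)"
    using line_derivative[OF u_differentiable[OF X(1)]] X(1) by (simp add: gradu_def grad_def)
  have T': "(x, max (t - 1) a) \<in> T" using t a R by (auto simp: cyl_def)
  note d2 = line_derivative[OF u_differentiable[OF T'], of i]
  have d3: "((\<lambda>s. u (fst X + fst (s *\<^sub>R coord_dir i :: (real ^ 'n) \<times> real), max (snd X - 1 + snd (s *\<^sub>R coord_dir i)) a))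
     has_real_derivative lag_grad X $ i) (at 0)"
  proof (cases i)
    case (Some k)
    then show ?thesis using d2 T' by (simp add: Pair lag_grad_def gradu_def grad_def max_def split: if_splits)
  next
    case None
    show ?thesis
    proof (cases "1 + a < t")
      case True
      have "eventually (\<lambda>s. s > a - (t - 1)) (at 0)"
        using True by (intro order_tendstoD(1)[OF tendsto_ident_at]) auto
      then show ?thesis
        using d2 T' None True
        by (intro DERIV_transform_eventually[OF d2[THEN DERIV_cong]])
          (auto simp: Pair lag_grad_def gradu_def grad_def max_def elim!: eventually_mono)
    next
      case False
      with t None have "t < 1 + a" by auto
      then have "eventually (\<lambda>s. s < 1 + a - t) (at 0)"
        by (intro order_tendstoD(2)[OF tendsto_ident_at]) auto
      then show ?thesis
        using None False \<open>t < 1 + a\<close>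
        by (intro DERIV_transform_eventually[OF DERIV_const[of "u (x, a)", THEN DERIV_cong]])
          (auto simp: Pair lag_grad_def max_def elim!: eventually_mono)
    qed
  qed
  have ev: "eventually (\<lambda>s. a < snd (X + s *\<^sub>R coord_dir i)) (at 0)"
  proof -
    have "((\<lambda>s. snd (X + s *\<^sub>R coord_dir i)) \<longlongrightarrow> snd (X + 0 *\<^sub>R coord_dir i)) (at 0)"
      by (intro tendsto_intros)
    then show ?thesis using X(2) by (intro order_tendstoD(1)) auto
  qed
  show ?thesis
    unfolding vector_minus_component
  proof (rule DERIV_transform_eventually[OF DERIV_diff[OF d1 d3]])
    show "eventually (\<lambda>s. u (X + s *\<^sub>R coord_dir i)
        - u (fst X + fst (s *\<^sub>R coord_dir i :: (real ^ 'n) \<times> real), max (snd X - 1 + snd (s *\<^sub>R coord_dir i)) a)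
        = lag_diff (X + s *\<^sub>R coord_dir i)) (at 0)"
      using ev line_eventually_T[OF X(1), of "coord_dir i"]
    proof eventually_elim
      case (elim s)
      then show ?case using surjective_pairing[of "X + s *\<^sub>R coord_dir i"]
        by (simp add: lag_diff_def max_def algebra_simps)
    qed
  qed (use X in \<open>simp add: lag_diff_def max_def\<close>)
qed

text \<open>
  A component of the flux multiplied by the test function, and its derivative in the direction of this component.
\<close>

definition tested :: "'n option \<Rightarrow> (real ^ 'n) \<times> real \<Rightarrow> real"
  where "tested i X = flux i X * (\<phi> X * lag_diff X)"

definition dtested :: "'n option \<Rightarrow> (real ^ 'n) \<times> real \<Rightarrow> real"
  where "dtested i X = (if a < snd X then dflux i X * (\<phi> X * lag_diff X)
      + flux i X * (\<phi>' X $ i * lag_diff X + \<phi> X * (gradu X - lag_grad X) $ i) else 0)"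

lemma outside_test_region:
  assumes "X \<notin> test_region"
  shows "tested i X = 0" "dtested i X = 0" "a < snd X \<Longrightarrow> \<phi> X = 0" "a < snd X \<Longrightarrow> \<phi>' X = 0"
proof -
  obtain x t where X: "X = (x, t)" by (cases X)
  have *: "t < a \<or> x \<notin> ball x\<^sub>0 (2 * R) \<or> 2 * R \<le> t"
    using assms by (auto simp: test_region_def X)
  moreover have "lag_diff X = 0" if "t \<le> a" using that a by (auto simp: lag_diff_def X max_def)
  ultimately show "tested i X = 0" "dtested i X = 0" "a < snd X \<Longrightarrow> \<phi> X = 0" "a < snd X \<Longrightarrow> \<phi>' X = 0"
    using cyl_cutoff_eq_0[OF R, of x x\<^sub>0 t] by (auto simp: tested_def dtested_def X)
qed

lemma dtested_bounded: obtains M where "0 \<le> M" "\<And>X. \<bar>dtested i X\<bar> \<le> M"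
proof -
  obtain Bf where Bf: "0 \<le> Bf" "\<And>X. X \<in> test_region \<Longrightarrow> \<bar>flux i X\<bar> \<le> Bf"
    using bounded_on_test_region[OF flux_continuous[of i]] by blast
  obtain Bd where Bd: "0 \<le> Bd" "\<And>X. X \<in> test_region \<Longrightarrow> \<bar>dflux i X\<bar> \<le> Bd"
    using bounded_on_test_region[OF dflux_continuous[of i]] by blast
  obtain Bw where Bw: "0 \<le> Bw" "\<And>X. X \<in> test_region \<Longrightarrow> \<bar>lag_diff X\<bar> \<le> Bw"
    using bounded_on_test_region[OF lag_diff_continuous] by blast
  obtain Bp where Bp: "0 \<le> Bp" "\<And>X. X \<in> test_region \<Longrightarrow> \<bar>gradu X $ i\<bar> \<le> Bp"
    using bounded_on_test_region[OF gradu_continuous] by blast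
  obtain Bg where Bg: "0 \<le> Bg" "\<And>X. X \<in> test_region \<Longrightarrow> \<bar>\<phi>' X $ i\<bar> \<le> Bg"
    using bounded_on_test_region[OF continuous_on_subset[OF continuous_cyl_cutoff_grad[OF R]]] by auto
  have Br: "\<bar>lag_grad X $ i\<bar> \<le> Bp" if "X \<in> test_region" for X
  proof -
    have "(fst X, a) \<in> test_region" "1 + a < snd X \<Longrightarrow> (fst X, snd X - 1) \<in> test_region"
      using that a R by (auto simp: test_region_def)
    then show ?thesis using Bp by (auto simp: lag_grad_def)
  qed
  have \<phi>: "\<bar>\<phi> X\<bar> \<le> 1" for X using cyl_cutoff_bounds[OF R, of x\<^sub>0 X] by simp
  have "\<bar>dtested i X\<bar> \<le> Bd * (1 * Bw) + Bf * (Bg * Bw + 1 * (Bp + Bp))" for X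
  proof (cases "X \<in> test_region \<and> a < snd X")
    case True
    then have X: "X \<in> test_region" by simp
    have "\<bar>dflux i X * (\<phi> X * lag_diff X) + flux i X * (\<phi>' X $ i * lag_diff X + \<phi> X * (gradu X - lag_grad X) $ i)\<bar>
      \<le> \<bar>dflux i X\<bar> * (\<bar>\<phi> X\<bar> * \<bar>lag_diff X\<bar>) + \<bar>flux i X\<bar> * (\<bar>\<phi>' X $ i\<bar> * \<bar>lag_diff X\<bar> + \<bar>\<phi> X\<bar> * (\<bar>gradu X $ i\<bar> + \<bar>lag_grad X $ i\<bar>))"
      unfolding abs_mult[symmetric] vector_minus_component
      by (intro order_trans[OF abs_triangle_ineq] add_mono order_refl)
        (auto simp: abs_mult intro!: mult_left_mono order_trans[OF abs_triangle_ineq] order_trans[OF abs_triangle_ineq4])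
    also have "\<dots> \<le> Bd * (1 * Bw) + Bf * (Bg * Bw + 1 * (Bp + Bp))"
      by (intro add_mono mult_mono Bd(2)[OF X] Bf(2)[OF X] Bw(2)[OF X] Bp(2)[OF X] Bg(2)[OF X] Br[OF X] \<phi>)
        (auto intro!: add_nonneg_nonneg mult_nonneg_nonneg Bd Bw Bf Bp Bg)
    finally show ?thesis using True by (simp add: dtested_def)
  next
    case False
    have "dtested i X = 0"
    proof (cases "X \<in> test_region")
      case True
      with False show ?thesis by (simp add: dtested_def)
    qed (rule outside_test_region(2))
    moreover have "0 \<le> Bd * (1 * Bw) + Bf * (Bg * Bw + 1 * (Bp + Bp))"
      by (auto intro!: add_nonneg_nonneg mult_nonneg_nonneg Bd Bw Bf Bp Bg)
    ultimately show ?thesis by simp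
  qed
  moreover have "0 \<le> Bd * (1 * Bw) + Bf * (Bg * Bw + 1 * (Bp + Bp))"
    by (auto intro!: add_nonneg_nonneg mult_nonneg_nonneg Bd Bw Bf Bp Bg)
  ultimately show thesis using that by blast
qed

lemma tested_continuous: "continuous_on UNIV (tested i)"
proof -
  have "continuous_on T (tested i)"
    unfolding tested_def
    by (intro continuous_intros flux_continuous lag_diff_continuous continuous_on_subset[OF continuous_cyl_cutoff[OF R]]) auto
  moreover have "continuous_on (- test_region) (tested i)"
    by (rule continuous_on_eq[OF continuous_on_const[of _ 0]]) (simp add: outside_test_region)
  ultimately have "continuous_on (T \<union> - test_region) (tested i)"
    using open_T compact_imp_closed[OF compact_test_region] by (intro continuous_on_open_Un) auto
  moreover have "T \<union> - test_region = UNIV" using test_region_subset_T by auto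
  ultimately show ?thesis by simp
qed

text \<open>
  The difference over one period is not differentiable in $t$ at the heights $a$ and $1 + a$. Lines in the directions
  of $x$ stay at one height and meet no kink.
\<close>

definition kinks :: "'n option \<Rightarrow> ((real ^ 'n) \<times> real) set"
  where "kinks i = (if i = None then {X. snd X = a} \<union> {X. snd X = 1 + a} else {})"

lemma tested_line_derivative:
  assumes "X \<notin> kinks i"
  shows "((\<lambda>s. tested i (X + s *\<^sub>R coord_dir i)) has_real_derivative dtested i X) (at 0)"
proof (cases "X \<in> test_region \<and> a < snd X")
  case True
  then have X: "X \<in> T" "a < snd X" "i = None \<Longrightarrow> snd X \<noteq> 1 + a"
    using test_region_subset_T assms by (auto simp: kinks_def)
  show ?thesis
    unfolding tested_def
    by (rule DERIV_cong[OF DERIV_mult[OF flux_line_derivative[OF X(1)]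
          DERIV_mult[OF cyl_cutoff_line_derivative[OF R] lag_diff_line_derivative[OF X]]]])
      (use X in \<open>simp_all add: dtested_def algebra_simps\<close>)
next
  case False
  have "eventually (\<lambda>s. tested i (X + s *\<^sub>R coord_dir i) = 0) (at 0)"
  proof (cases "X \<in> test_region")
    case True
    then have "snd X = a" using False by (auto simp: test_region_def)
    with assms obtain k where "i = Some k" by (cases i) (auto simp: kinks_def)
    then have "tested i (X + s *\<^sub>R coord_dir i) = 0" for s
      using \<open>snd X = a\<close> a by (simp add: tested_def lag_diff_def max_def)
    then show ?thesis by simp
  next
    case False
    have "((\<lambda>s. X + s *\<^sub>R coord_dir i) \<longlongrightarrow> X + 0 *\<^sub>R coord_dir i) (at 0)" by (intro tendsto_intros)
    then have "eventually (\<lambda>s. X + s *\<^sub>R coord_dir i \<in> - test_region) (at 0)"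
      using False compact_imp_closed[OF compact_test_region] by (intro topological_tendstoD) auto
    then show ?thesis by eventually_elim (simp add: outside_test_region)
  qed
  moreover have "dtested i X = 0" "tested i X = 0"
    using False outside_test_region(1,2)[of X i] a by (auto simp: dtested_def tested_def lag_diff_def max_def test_region_def)
  ultimately show ?thesis
    using DERIV_transform_eventually[OF DERIV_const[of 0], of "\<lambda>s. tested i (X + s *\<^sub>R coord_dir i)"]
    by (auto elim: eventually_mono)
qed

lemma integral_dtested: "integrable lborel (dtested i)" "(\<integral>X. dtested i X \<partial>lborel) = 0"
proof -
  obtain M where M: "0 \<le> M" "\<And>X. \<bar>dtested i X\<bar> \<le> M" using dtested_bounded[of i] by blast
  have m: "dtested i \<in> borel_measurable borel"
    unfolding dtested_def [abs_def] vector_minus_component by measurable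
  have N: "kinks i \<in> null_sets lborel"
    by (auto simp: kinks_def intro!: null_sets.Un hyperplane_null)
  have fin: "finite {s. X + s *\<^sub>R coord_dir i \<in> kinks i}" for X
  proof -
    have "{s. X + s *\<^sub>R coord_dir i \<in> kinks i} \<subseteq> {a - snd X, 1 + a - snd X}"
      by (auto simp: kinks_def split: if_splits)
    then show ?thesis using finite_subset by blast
  qed
  show "integrable lborel (dtested i)" "(\<integral>X. dtested i X \<partial>lborel) = 0"
    by (rule integral_directional_derivative_eq_0[OF tested_continuous
      compact_imp_bounded[OF compact_test_region] outside_test_region(1) m N fin tested_line_derivative M(2) M(1)]; assumption)+
qed

text \<open>
  Summing over the components the vanishing integrals of the derivatives of \<open>tested\<close>, the second
  derivatives of $u$ combine to the divergence of the flux, which is zero.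
\<close>

lemma weak_identity:
  defines "J \<equiv> \<lambda>X. if a < snd X then lag_diff X * form (A X) (\<phi>' X) (gradu X) + \<phi> X * form (A X) (gradu X - lag_grad X) (gradu X) else 0"
  shows "integrable lborel J" "(\<integral>X. J X \<partial>lborel) = 0"
proof -
  have "(\<Sum>i\<in>UNIV. dtested i X) = J X" for X
  proof (cases "a < snd X \<and> X \<in> T")
    case True
    have div: "(\<Sum>i\<in>UNIV. dflux i X) = 0"
      using True solution[of X] by (simp add: dflux_def elliptic_op_def divergence_def)
    have f: "flux i X = (A X *v gradu X) $ i" for i using True by (simp add: flux_def gradu_def)
    have "(\<Sum>i\<in>UNIV. dtested i X) = (\<Sum>i\<in>UNIV. dflux i X) * (\<phi> X * lag_diff X)
        + (\<Sum>i\<in>UNIV. flux i X * (\<phi>' X $ i * lag_diff X + \<phi> X * (gradu X - lag_grad X) $ i))"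
      using True by (simp add: dtested_def sum.distrib sum_distrib_right)
    also have "(\<Sum>i\<in>UNIV. flux i X * (\<phi>' X $ i * lag_diff X + \<phi> X * (gradu X - lag_grad X) $ i)) = J X"
      using True unfolding J_def form_def inner_vec_def f
      by (simp add: sum_distrib_left sum.distrib[symmetric] algebra_simps)
    finally show ?thesis by (simp add: div)
  next
    case False
    then show ?thesis by (auto simp: J_def dtested_def dflux_def flux_def gradu_def)
  qed
  then have eq: "J = (\<lambda>X. \<Sum>i\<in>UNIV. dtested i X)" by auto
  show "integrable lborel J" "(\<integral>X. J X \<partial>lborel) = 0"
    unfolding eq using integral_dtested by simp_all
qed


section \<open>The size of the difference over one period\<close>

text \<open>
  Every point that lies at most one period below the support of $\nabla\varphi$, and not below height \<open>a\<close>,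
  belongs to this part of $T(x_0,2R)\setminus T(x_0,R)$.
\<close>

definition shell :: "((real ^ 'n) \<times> real) set"
  where "shell = {X. fst X \<in> ball x\<^sub>0 (2 * R) \<and> a \<le> snd X \<and> snd X < 2 * R \<and> \<not> (fst X \<in> ball x\<^sub>0 R \<and> snd X < R)}"

definition I_shell :: real
  where "I_shell = (\<integral>X. indicator shell X * (norm (gradu X))\<^sup>2 \<partial>lborel)"

definition I_bottom :: real
  where "I_bottom = (\<integral>x. indicator (ball x\<^sub>0 (2 * R)) x * (\<Sum>k\<in>UNIV. (gradu (x, a) $ Some k)\<^sup>2) \<partial>lborel)"

lemma shell_subset_test_region: "shell \<subseteq> test_region"
  by (auto simp: shell_def test_region_def)

lemma shell_measurable [measurable]: "shell \<in> sets borel"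
proof -
  have "shell = (ball x\<^sub>0 (2 * R) \<times> {a..<2 * R}) - (ball x\<^sub>0 R \<times> {..<R})"
    by (auto simp: shell_def)
  then show ?thesis
    by (simp add: borel_prod[symmetric])
qed

lemma norm_gradu_measurable [measurable]: "(\<lambda>X. (norm (gradu X))\<^sup>2) \<in> borel_measurable borel"
  unfolding norm_sq_eq_sum by measurable

lemma norm_gradu_bounded: obtains B where "0 \<le> B" "\<And>X. X \<in> test_region \<Longrightarrow> (norm (gradu X))\<^sup>2 \<le> B"
proof -
  have "continuous_on T (\<lambda>X. (norm (gradu X))\<^sup>2)"
    unfolding norm_sq_eq_sum by (intro continuous_intros gradu_continuous)
  from bounded_on_test_region[OF this] show thesis using that by auto
qed

lemma integrable_on_test_region:
  assumes "g \<in> borel_measurable borel" "\<And>X. X \<notin> test_region \<Longrightarrow> g X = 0" "\<And>X. X \<in> test_region \<Longrightarrow> \<bar>g X\<bar> \<le> B"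
  shows "integrable lborel (g :: _ \<Rightarrow> real)"
proof (rule integrable_bounded_support[OF assms(1) compact_imp_bounded[OF compact_test_region] assms(2)])
  show "\<bar>g X\<bar> \<le> max B 0" for X using assms(2,3)[of X] by (cases "X \<in> test_region") auto
qed

lemma integrable_shell: "integrable lborel (\<lambda>X. indicator shell X * (norm (gradu X))\<^sup>2)"
proof -
  obtain B where "0 \<le> B" "\<And>X. X \<in> test_region \<Longrightarrow> (norm (gradu X))\<^sup>2 \<le> B" using norm_gradu_bounded by blast
  then show ?thesis
    using shell_subset_test_region by (intro integrable_on_test_region[where B=B]) (auto simp: indicator_def)
qed

text \<open>
  The fundamental theorem of calculus on $[\max(t-1,a),t]$ and the Cauchy-Schwarz inequality; the interval has
  length at most $1$. Where $\nabla\varphi \neq 0$, the segment below $(x,t)$ lies in the shell.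
\<close>

lemma lag_diff_sq_le:
  assumes X: "a < t" "\<phi>' (x, t) \<noteq> 0"
  shows "ennreal ((lag_diff (x, t))\<^sup>2)
    \<le> (\<integral>\<^sup>+s. indicator {-1..0} s * ennreal (indicator shell ((x, t) + (0, s)) * (norm (gradu ((x, t) + (0, s))))\<^sup>2) \<partial>lborel)"
proof -
  have x: "x \<in> ball x\<^sub>0 (2 * R)" "t < 2 * R" "\<not> (x \<in> ball x\<^sub>0 R \<and> t \<le> R + 2)"
    using X cyl_cutoff_eq_0[OF R, of x x\<^sub>0 t] cyl_cutoff_plateau[OF R, of x x\<^sub>0 t] by force+
  define \<alpha> where "\<alpha> = max (t - 1) a"
  have \<alpha>: "\<alpha> \<le> t" "t - 1 \<le> \<alpha>" "a \<le> \<alpha>" using X by (auto simp: \<alpha>_def)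
  define g where "g \<tau> = gradu (x, \<tau>) $ None" for \<tau>
  have inT: "(x, \<tau>) \<in> T" if "\<alpha> \<le> \<tau>" "\<tau> \<le> t" for \<tau>
    using x that a \<alpha> R by (auto simp: cyl_def)
  have der: "((\<lambda>\<tau>. u (x, \<tau>)) has_real_derivative g \<tau>) (at \<tau>)" if "\<alpha> \<le> \<tau>" "\<tau> \<le> t" for \<tau>
  proof -
    have "((\<lambda>s. u (x, \<tau> + s)) has_real_derivative g \<tau>) (at 0)"
      using line_derivative[OF u_differentiable[OF inT[OF that]], of None] inT[OF that]
      by (simp add: g_def gradu_def grad_def)
    then show ?thesis using DERIV_shift[of "\<lambda>\<tau>. u (x, \<tau>)" "g \<tau>" 0 \<tau>] by (simp add: add.commute)
  qed
  have cont: "isCont g \<tau>" if "\<alpha> \<le> \<tau>" "\<tau> \<le> t" for \<tau>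
  proof -
    have "isCont (\<lambda>X. gradu X $ None) (x, \<tau>)"
      using gradu_continuous[of None] inT[OF that] by (simp add: continuous_on_eq_continuous_at[OF open_T])
    then have "isCont (\<lambda>\<tau>. (\<lambda>X. gradu X $ None) (x, \<tau>)) \<tau>"
      by (rule isCont_o2[where g="\<lambda>X. gradu X $ None", rotated]) (intro continuous_intros)
    then show ?thesis by (simp add: g_def [abs_def])
  qed
  have g_meas [measurable]: "g \<in> borel_measurable borel"
    unfolding g_def [abs_def]
    by (rule measurable_compose[OF _ gradu_measurable]) (intro borel_measurable_continuous_onI continuous_intros)
  have hb: "has_bochner_integral lborel (\<lambda>\<tau>. g \<tau> * indicator {\<alpha>..t} \<tau>) (lag_diff (x, t))"
  proof -
    have "has_bochner_integral lborel (\<lambda>\<tau>. g \<tau> * indicator {\<alpha>..t} \<tau>) (u (x, t) - u (x, \<alpha>))"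
      by (rule has_bochner_integral_FTC_Icc_real[OF \<alpha>(1) der cont])
    moreover have "lag_diff (x, t) = u (x, t) - u (x, \<alpha>)"
      using inT[OF \<alpha>(1) order_refl] X by (simp add: lag_diff_def \<alpha>_def max_def)
    ultimately show ?thesis by simp
  qed
  have "ennreal ((lag_diff (x, t))\<^sup>2) = (ennreal (norm (lag_diff (x, t))))\<^sup>2"
    by (simp add: ennreal_power)
  also have "\<dots> \<le> (\<integral>\<^sup>+\<tau>. ennreal (norm (g \<tau> * indicator {\<alpha>..t} \<tau>)) \<partial>lborel)\<^sup>2"
    unfolding has_bochner_integral_integral_eq[OF hb, symmetric]
    by (intro power_mono integral_norm_bound_ennreal) (use hb in \<open>auto simp: has_bochner_integral_iff\<close>)
  also have "(\<integral>\<^sup>+\<tau>. ennreal (norm (g \<tau> * indicator {\<alpha>..t} \<tau>)) \<partial>lborel)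
      = (\<integral>\<^sup>+\<tau>. ennreal (\<bar>g \<tau>\<bar> * indicator {\<alpha>..t} \<tau>) * indicator {\<alpha>..t} \<tau> \<partial>lborel)"
    by (intro nn_integral_cong) (auto simp: indicator_def)
  also have "\<dots>\<^sup>2 \<le> (\<integral>\<^sup>+\<tau>. (ennreal (\<bar>g \<tau>\<bar> * indicator {\<alpha>..t} \<tau>))\<^sup>2 \<partial>lborel) * (\<integral>\<^sup>+\<tau>. (indicator {\<alpha>..t} \<tau>)\<^sup>2 \<partial>lborel)"
    by (rule Cauchy_Schwarz_nn_integral) auto
  also have "\<dots> \<le> (\<integral>\<^sup>+\<tau>. (ennreal (\<bar>g \<tau>\<bar> * indicator {\<alpha>..t} \<tau>))\<^sup>2 \<partial>lborel) * 1"
  proof (rule mult_left_mono)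
    have "(\<integral>\<^sup>+\<tau>. (indicator {\<alpha>..t} \<tau> :: ennreal)\<^sup>2 \<partial>lborel) = (\<integral>\<^sup>+\<tau>. indicator {\<alpha>..t} \<tau> \<partial>lborel)"
      by (intro nn_integral_cong) (auto simp: indicator_def)
    also have "\<dots> \<le> 1" using \<alpha> by (simp add: ennreal_le_1)
    finally show "(\<integral>\<^sup>+\<tau>. (indicator {\<alpha>..t} \<tau> :: ennreal)\<^sup>2 \<partial>lborel) \<le> 1" .
  qed simp
  also have "\<dots> = (\<integral>\<^sup>+s. (ennreal (\<bar>g (t + s)\<bar> * indicator {\<alpha>..t} (t + s)))\<^sup>2 \<partial>lborel)"
    by (subst nn_integral_lborel_translate) auto
  also have "\<dots> \<le> (\<integral>\<^sup>+s. indicator {-1..0} s * ennreal (indicator shell ((x, t) + (0, s)) * (norm (gradu ((x, t) + (0, s))))\<^sup>2) \<partial>lborel)"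
  proof (rule nn_integral_mono)
    fix s :: real
    show "(ennreal (\<bar>g (t + s)\<bar> * indicator {\<alpha>..t} (t + s)))\<^sup>2
      \<le> indicator {-1..0} s * ennreal (indicator shell ((x, t) + (0, s)) * (norm (gradu ((x, t) + (0, s))))\<^sup>2)"
    proof (cases "\<alpha> \<le> t + s \<and> t + s \<le> t")
      case True
      then have "(x, t + s) \<in> shell" "s \<in> {-1..0}" using x \<alpha> by (auto simp: shell_def)
      moreover have "(g (t + s))\<^sup>2 \<le> (norm (gradu (x, t + s)))\<^sup>2"
        unfolding norm_sq_eq_sum g_def by (rule member_le_sum) auto
      ultimately show ?thesis using True by (simp add: ennreal_power)
    qed (auto simp: indicator_def)
  qed
  finally show ?thesis .
qed

text \<open>
  After exchanging the integrals, each vertical translate of the integrand over the shell has the same integral,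
  and the translations range over an interval of length $1$.
\<close>

lemma integral_lag_diff_sq_le:
  "integrable lborel (\<lambda>X. indicator {X. a < snd X \<and> \<phi>' X \<noteq> 0} X * (lag_diff X)\<^sup>2)"
  "(\<integral>X. indicator {X. a < snd X \<and> \<phi>' X \<noteq> 0} X * (lag_diff X)\<^sup>2 \<partial>lborel) \<le> I_shell"
proof -
  let ?D = "{X. a < snd X \<and> \<phi>' X \<noteq> 0}"
  define g where "g X = indicator shell X * (norm (gradu X))\<^sup>2" for X
  have g [measurable]: "g \<in> borel_measurable borel" unfolding g_def by measurable
  have "?D = {X. a < snd X} - (\<Inter>i. {X. \<phi>' X $ i = 0})" by (auto simp: vec_eq_iff)
  moreover have "{X. \<phi>' X $ i = 0} \<in> sets borel" for i by measurable
  ultimately have D [measurable]: "?D \<in> sets borel" by auto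
  obtain B where B: "0 \<le> B" "\<And>X. X \<in> test_region \<Longrightarrow> \<bar>lag_diff X\<bar> \<le> B" using bounded_on_test_region[OF lag_diff_continuous] by blast
  show int: "integrable lborel (\<lambda>X. indicator ?D X * (lag_diff X)\<^sup>2)"
  proof (rule integrable_on_test_region[where B="B\<^sup>2"])
    show "\<bar>indicator ?D X * (lag_diff X)\<^sup>2\<bar> \<le> B\<^sup>2" if "X \<in> test_region" for X
      using B(2)[OF that] B(1) by (auto simp: indicator_def abs_le_square_iff[symmetric])
    show "(\<lambda>X. indicator ?D X * (lag_diff X)\<^sup>2) \<in> borel_measurable borel" by measurable
    show "indicator ?D X * (lag_diff X)\<^sup>2 = 0" if "X \<notin> test_region" for X
      using outside_test_region(4)[OF that] by (auto simp: indicator_def)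
  qed
  have shift: "(\<lambda>(X, s). X + (0, s) :: (real ^ 'n) \<times> real) \<in> borel_measurable (lborel \<Otimes>\<^sub>M lborel)"
  proof -
    have "(\<lambda>(X, s). X + (0, s) :: (real ^ 'n) \<times> real) \<in> borel_measurable borel"
      unfolding case_prod_beta by (intro borel_measurable_continuous_onI continuous_intros)
    then show ?thesis by (simp add: lborel_prod)
  qed
  have "ennreal (\<integral>X. indicator ?D X * (lag_diff X)\<^sup>2 \<partial>lborel) = (\<integral>\<^sup>+X. ennreal (indicator ?D X * (lag_diff X)\<^sup>2) \<partial>lborel)"
    by (rule nn_integral_eq_integral[symmetric, OF int]) auto
  also have "\<dots> \<le> (\<integral>\<^sup>+X. \<integral>\<^sup>+s. indicator {-1..0} s * ennreal (g (X + (0, s))) \<partial>lborel \<partial>lborel)"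
  proof (rule nn_integral_mono)
    fix X :: "(real ^ 'n) \<times> real"
    show "ennreal (indicator ?D X * (lag_diff X)\<^sup>2) \<le> (\<integral>\<^sup>+s. indicator {-1..0} s * ennreal (g (X + (0, s))) \<partial>lborel)"
      using lag_diff_sq_le[of "snd X" "fst X"] by (cases "X \<in> ?D") (auto simp: g_def)
  qed
  also have "\<dots> = (\<integral>\<^sup>+s. \<integral>\<^sup>+X. indicator {-1..0} s * ennreal (g (X + (0, s))) \<partial>lborel \<partial>lborel)"
  proof (rule lborel_pair.Fubini'[symmetric])
    have [measurable]: "(\<lambda>z. g (fst z + (0, snd z))) \<in> borel_measurable (lborel \<Otimes>\<^sub>M lborel)"
      using measurable_compose[OF shift g] by (simp add: case_prod_beta)
    show "(\<lambda>(X, s). indicator {-1..0} s * ennreal (g (X + (0, s)))) \<in> borel_measurable (lborel \<Otimes>\<^sub>M lborel)"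
      unfolding case_prod_beta by measurable
  qed
  also have "\<dots> = (\<integral>\<^sup>+s. indicator {-1..(0::real)} s * (\<integral>\<^sup>+X. ennreal (g X) \<partial>lborel) \<partial>lborel)"
  proof (rule nn_integral_cong)
    fix s :: real
    have "(\<lambda>X. g (X + (0, s))) \<in> borel_measurable borel"
      by (rule measurable_compose[OF _ g]) (intro borel_measurable_continuous_onI continuous_intros)
    then show "(\<integral>\<^sup>+X. indicator {-1..0} s * ennreal (g (X + (0, s))) \<partial>lborel) = indicator {-1..0} s * (\<integral>\<^sup>+X. ennreal (g X) \<partial>lborel)"
      using nn_integral_lborel_translate[of "\<lambda>X. ennreal (g X)" "(0, s)"]
      by (simp add: nn_integral_cmult add.commute)
  qed
  also have "\<dots> = (\<integral>\<^sup>+X. ennreal (g X) \<partial>lborel)" by (simp add: nn_integral_multc)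
  also have "\<dots> = ennreal I_shell"
    unfolding I_shell_def g_def by (rule nn_integral_eq_integral[OF integrable_shell]) auto
  finally show "(\<integral>X. indicator ?D X * (lag_diff X)\<^sup>2 \<partial>lborel) \<le> I_shell"
    by (subst (asm) ennreal_le_iff) (auto simp: I_shell_def intro!: integral_nonneg)
qed


section \<open>The energy inequality above a fixed height\<close>

abbreviation energy :: "(real ^ 'n) \<times> real \<Rightarrow> real ^ 'n option \<Rightarrow> real"
  where "energy X \<xi> \<equiv> form (A X) \<xi> \<xi>"

lemma energy_bounds: "\<mu> * (norm \<xi>)\<^sup>2 \<le> energy X \<xi>" "energy X \<xi> \<le> inverse \<mu> * (norm \<xi>)\<^sup>2" "0 \<le> energy X \<xi>"
proof -
  show *: "\<mu> * (norm \<xi>)\<^sup>2 \<le> energy X \<xi>" "energy X \<xi> \<le> inverse \<mu> * (norm \<xi>)\<^sup>2"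
    using elliptic unfolding elliptic_matrix_def form_eq_sum by blast+
  show "0 \<le> energy X \<xi>" using * \<mu>_pos by (meson mult_nonneg_nonneg less_imp_le order_trans zero_le_power2)
qed

lemma form_measurable [measurable]:
  assumes [measurable]: "\<And>i. (\<lambda>X. \<xi> X $ i) \<in> borel_measurable borel" "\<And>i. (\<lambda>X. \<zeta> X $ i) \<in> borel_measurable borel"
  shows "(\<lambda>X. form (A X) (\<xi> X) (\<zeta> X)) \<in> borel_measurable borel"
  unfolding form_eq_sum by measurable

lemma lag_grad_sq_low: "snd X \<le> 1 + a \<Longrightarrow> (norm (lag_grad X))\<^sup>2 = (\<Sum>k\<in>UNIV. (gradu (fst X, a) $ Some k)\<^sup>2)"
  by (simp add: norm_sq_eq_sum sum_UNIV_option lag_grad_def)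

lemma lag_grad_high: "1 + a < snd X \<Longrightarrow> lag_grad X = gradu (fst X, snd X - 1)"
  by (simp add: lag_grad_def vec_eq_iff)

lemma tangential_sq_le: "(\<Sum>k\<in>UNIV. (gradu X $ Some k)\<^sup>2) \<le> (norm (gradu X))\<^sup>2"
  by (simp add: norm_sq_eq_sum sum_UNIV_option)

abbreviation bottom_density :: "real ^ 'n \<Rightarrow> real"
  where "bottom_density x \<equiv> indicator (ball x\<^sub>0 (2 * R)) x * (\<Sum>k\<in>UNIV. (gradu (x, a) $ Some k)\<^sup>2)"

lemma bottom_density_nonneg: "0 \<le> bottom_density x"
  by (simp add: sum_nonneg)

lemma integral_bottom_density:
  "integrable lborel (\<lambda>X. indicator {a<..1 + a} (snd X) * bottom_density (fst X))"
  "(\<integral>X. indicator {a<..1 + a} (snd X) * bottom_density (fst X) \<partial>lborel) = I_bottom"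
proof -
  obtain B where B: "0 \<le> B" "\<And>X. X \<in> test_region \<Longrightarrow> (norm (gradu X))\<^sup>2 \<le> B" using norm_gradu_bounded by blast
  have meas: "bottom_density \<in> borel_measurable borel"
  proof -
    have "(\<lambda>x. gradu (x, a) $ i) \<in> borel_measurable borel" for i
      by (rule measurable_compose[OF _ gradu_measurable]) (intro borel_measurable_continuous_onI continuous_intros)
    then show ?thesis
      by (intro borel_measurable_times borel_measurable_indicator borel_measurable_sum
          borel_measurable_power) auto
  qed
  have bound: "\<bar>bottom_density x\<bar> \<le> B" for x
  proof (cases "x \<in> ball x\<^sub>0 (2 * R)")
    case True
    then have "(x, a) \<in> test_region" using R a by (auto simp: test_region_def)
    then show ?thesis
      using True order_trans[OF tangential_sq_le B(2)] by (simp add: sum_nonneg)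
  qed (use B in simp)
  have out: "bottom_density x = 0" if "x \<notin> ball x\<^sub>0 (2 * R)" for x using that by simp
  note slab = integral_lborel_slab[OF meas bounded_ball out bound, where \<alpha>=a and \<beta>="1 + a"]
  show "integrable lborel (\<lambda>X. indicator {a<..1 + a} (snd X) * bottom_density (fst X))"
    by (rule slab(1)) simp_all
  show "(\<integral>X. indicator {a<..1 + a} (snd X) * bottom_density (fst X) \<partial>lborel) = I_bottom"
    using slab(2) by (simp add: I_bottom_def)
qed

lemma gradients_bounded:
  obtains B where "0 \<le> B" "\<And>X. X \<in> test_region \<Longrightarrow> (norm (gradu X))\<^sup>2 \<le> B" "\<And>X. X \<in> test_region \<Longrightarrow> (norm (lag_grad X))\<^sup>2 \<le> B"
    "\<And>X. X \<in> test_region \<Longrightarrow> (norm (gradu X - lag_grad X))\<^sup>2 \<le> 4 * B"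
proof -
  obtain B where B: "0 \<le> B" "\<And>X. X \<in> test_region \<Longrightarrow> (norm (gradu X))\<^sup>2 \<le> B" using norm_gradu_bounded by blast
  have lag_grad: "(norm (lag_grad X))\<^sup>2 \<le> B" if X: "X \<in> test_region" for X
  proof (cases "1 + a < snd X")
    case True
    then have "(fst X, snd X - 1) \<in> test_region" using X by (auto simp: test_region_def)
    then show ?thesis using B(2) True by (simp add: lag_grad_high)
  next
    case False
    have "(fst X, a) \<in> test_region" using X R a by (auto simp: test_region_def)
    then have "(\<Sum>k\<in>UNIV. (gradu (fst X, a) $ Some k)\<^sup>2) \<le> B"
      using B(2) tangential_sq_le order_trans by blast
    then show ?thesis using False by (simp add: lag_grad_sq_low)
  qed
  have "(norm (gradu X - lag_grad X))\<^sup>2 \<le> 4 * B" if X: "X \<in> test_region" for X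
    using norm_diff_sq_bound[of "gradu X - lag_grad X" "- lag_grad X"] B(2)[OF X] lag_grad[OF X] by simp
  then show thesis using that B lag_grad by blast
qed

text \<open>
  The cutoff confines the integrand to \<open>test_region\<close>, provided that \<open>S\<close> lies
  above height \<open>a\<close>: below, the cutoff does not vanish.
\<close>

lemma integrable_cutoff_energy:
  assumes [measurable]: "\<And>i. (\<lambda>X. \<xi> X $ i) \<in> borel_measurable borel" "S \<in> sets borel"
    and S: "S \<subseteq> {X. a < snd X}" and B: "\<And>X. X \<in> test_region \<Longrightarrow> (norm (\<xi> X))\<^sup>2 \<le> B"
  shows "integrable lborel (\<lambda>X. indicator S X * (\<phi> X * energy X (\<xi> X)))"
proof (rule integrable_on_test_region)
  show "(\<lambda>X. indicator S X * (\<phi> X * energy X (\<xi> X))) \<in> borel_measurable borel" by measurable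
  show "indicator S X * (\<phi> X * energy X (\<xi> X)) = 0" if "X \<notin> test_region" for X
    using outside_test_region(3)[OF that] S by (auto simp: indicator_def)
  show "\<bar>indicator S X * (\<phi> X * energy X (\<xi> X))\<bar> \<le> inverse \<mu> * B" if "X \<in> test_region" for X
  proof -
    have "energy X (\<xi> X) \<le> inverse \<mu> * B"
      using energy_bounds(2)[of X "\<xi> X"] B[OF that] \<mu>_pos
      by (meson inverse_nonnegative_iff_nonnegative less_imp_le mult_left_mono order_trans)
    moreover have "\<phi> X * energy X (\<xi> X) \<le> 1 * energy X (\<xi> X)"
      by (intro mult_right_mono cyl_cutoff_bounds[OF R] energy_bounds)
    moreover have "0 \<le> \<phi> X * energy X (\<xi> X)"
      by (intro mult_nonneg_nonneg cyl_cutoff_bounds[OF R] energy_bounds)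
    ultimately show ?thesis using energy_bounds(3)[of X "\<xi> X"] by (auto simp: indicator_def)
  qed
qed

lemma A_shift: "A (X + (0, 1)) = A X"
  using periodic[of "fst X" "snd X"] by (cases X) simp

text \<open>
  The first term on the right comes from the slab, the second from the gradient of the cutoff. The constant is
  $65 = 1 + 64$: Young's inequality with weight $R$ leaves, up to the factor $1/\mu$, $|\nabla u|^2/R$ and
  $R\,|\nabla\varphi|^2 w^2$, where $|\nabla\varphi|^2 \le 64/R^2$.
\<close>

lemma cutoff_energy_inequality:
  "(\<integral>X. indicator {X. a < snd X} X * (\<phi> X * energy X (gradu X - lag_grad X)) \<partial>lborel)
    \<le> inverse \<mu> * I_bottom + 65 * inverse \<mu> / R * I_shell"
proof -
  let ?O = "{X :: (real ^ 'n) \<times> real. a < snd X}" and ?O1 = "{X :: (real ^ 'n) \<times> real. 1 + a < snd X}"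
  let ?S = "?O - ?O1" and ?D = "{X. a < snd X \<and> \<phi>' X \<noteq> 0}"
  obtain B where B: "0 \<le> B" "\<And>X. X \<in> test_region \<Longrightarrow> (norm (gradu X))\<^sup>2 \<le> B" "\<And>X. X \<in> test_region \<Longrightarrow> (norm (lag_grad X))\<^sup>2 \<le> B"
    "\<And>X. X \<in> test_region \<Longrightarrow> (norm (gradu X - lag_grad X))\<^sup>2 \<le> 4 * B" using gradients_bounded by blast
  define f1 where "f1 X = indicator ?O X * (\<phi> X * energy X (gradu X - lag_grad X))" for X
  define f2 where "f2 X = indicator ?O X * (\<phi> X * energy X (lag_grad X))" for X
  define f3 where "f3 X = indicator ?O X * (\<phi> X * energy X (gradu X))" for X
  define f4 where "f4 X = indicator ?O X * (lag_diff X * form (A X) (\<phi>' X) (gradu X))" for X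
  have i1: "integrable lborel f1" unfolding f1_def by (rule integrable_cutoff_energy[OF _ _ _ B(4)]) auto
  have i2: "integrable lborel f2" unfolding f2_def by (rule integrable_cutoff_energy[OF _ _ _ B(3)]) auto
  have i3: "integrable lborel f3" unfolding f3_def by (rule integrable_cutoff_energy[OF _ _ _ B(2)]) auto
  define J where "J X = (if a < snd X then lag_diff X * form (A X) (\<phi>' X) (gradu X) + \<phi> X * form (A X) (gradu X - lag_grad X) (gradu X) else 0)" for X
  have J: "integrable lborel J" "(\<integral>X. J X \<partial>lborel) = 0" using weak_identity unfolding J_def by auto
  have J_eq: "J X = f4 X + (f3 X + f1 X - f2 X) / 2" for X
  proof -
    have "form (A X) (gradu X - lag_grad X) (gradu X) = (energy X (gradu X) + energy X (gradu X - lag_grad X) - energy X (lag_grad X)) / 2"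
      using form_diff_self[OF symmetric, of X "gradu X" "lag_grad X"] by simp
    then show ?thesis
      unfolding J_def f1_def f2_def f3_def f4_def by (simp only:) (simp add: field_simps)
  qed
  then have "f4 = (\<lambda>X. J X - (f3 X + f1 X - f2 X) / 2)" by (simp add: fun_eq_iff)
  then have i4: "integrable lborel f4" using J i1 i2 i3 by simp
  have identity: "(\<integral>X. f1 X \<partial>lborel) = (\<integral>X. f2 X \<partial>lborel) - (\<integral>X. f3 X \<partial>lborel) - 2 * (\<integral>X. f4 X \<partial>lborel)"
    using J(2) i1 i2 i3 i4 unfolding J_eq by (simp add: field_simps)

  \<comment> \<open>The part of the second energy above the slab is a translate of the third energy by one period.\<close>
  have f2_le: "(\<integral>X. f2 X \<partial>lborel) - (\<integral>X. f3 X \<partial>lborel) \<le> inverse \<mu> * I_bottom"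
  proof -
    define g where "g X = indicator ?S X * (\<phi> X * energy X (lag_grad X))" for X
    define h where "h X = indicator ?O1 X * (\<phi> X * energy X (lag_grad X))" for X
    have ig: "integrable lborel g" unfolding g_def by (rule integrable_cutoff_energy[OF _ _ _ B(3)]) auto
    have ih: "integrable lborel h" unfolding h_def by (rule integrable_cutoff_energy[OF _ _ _ B(3)]) auto
    have [measurable]: "h \<in> borel_measurable borel" unfolding h_def by measurable
    have "(\<integral>X. h X \<partial>lborel) = (\<integral>X. h ((0, 1) + X) \<partial>lborel)"
      by (rule integral_lborel_translate(1)[symmetric]) simp
    also have "\<dots> \<le> (\<integral>X. f3 X \<partial>lborel)"
    proof (rule integral_mono)
      show "integrable lborel (\<lambda>X. h ((0, 1) + X))" by (rule integral_lborel_translate(2)[OF _ ih]) simp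
      show "h ((0, 1) + X) \<le> f3 X" for X
      proof (cases "a < snd X")
        case True
        have "\<phi> ((0, 1) + X) \<le> \<phi> X"
          using cyl_cutoff_antimono[OF R, of "snd X" "1 + snd X" x\<^sub>0 "fst X"] by (cases X) simp
        then have "\<phi> ((0, 1) + X) * energy X (gradu X) \<le> \<phi> X * energy X (gradu X)"
          by (rule mult_right_mono[OF _ energy_bounds(3)])
        then show ?thesis using True A_shift[of X]
          by (simp add: h_def f3_def lag_grad_high add.commute[of _ X])
      qed (simp add: h_def f3_def)
    qed (rule i3)
    finally have h_le: "(\<integral>X. h X \<partial>lborel) \<le> (\<integral>X. f3 X \<partial>lborel)" .
    have "(\<integral>X. g X \<partial>lborel) \<le> (\<integral>X. inverse \<mu> * (indicator {a<..1 + a} (snd X) * bottom_density (fst X)) \<partial>lborel)"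
    proof (rule integral_mono[OF ig])
      show "integrable lborel (\<lambda>X. inverse \<mu> * (indicator {a<..1 + a} (snd X) * bottom_density (fst X)))"
        using integral_bottom_density(1) by simp
      show "g X \<le> inverse \<mu> * (indicator {a<..1 + a} (snd X) * bottom_density (fst X))" for X
      proof (cases "X \<in> ?S \<and> fst X \<in> ball x\<^sub>0 (2 * R)")
        case True
        have "\<phi> X * energy X (lag_grad X) \<le> 1 * (inverse \<mu> * (norm (lag_grad X))\<^sup>2)"
          by (intro mult_mono cyl_cutoff_bounds[OF R] energy_bounds) simp
        then show ?thesis using True by (simp add: g_def lag_grad_sq_low)
      next
        case False
        then have "g X = 0" using cyl_cutoff_eq_0(1)[OF R, of "fst X" x\<^sub>0 "snd X"]
          by (auto simp: g_def indicator_def)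
        moreover note bottom_density_nonneg[of "fst X"]
        ultimately show ?thesis using \<mu>_pos by simp
      qed
    qed
    also have "\<dots> = inverse \<mu> * I_bottom"
      using integral_bottom_density(2) by simp
    finally have g_le: "(\<integral>X. g X \<partial>lborel) \<le> inverse \<mu> * I_bottom" .
    have "f2 X = g X + h X" for X by (auto simp: f2_def g_def h_def indicator_def)
    then have "(\<integral>X. f2 X \<partial>lborel) = (\<integral>X. g X \<partial>lborel) + (\<integral>X. h X \<partial>lborel)"
      using ig ih by simp
    with h_le g_le show ?thesis by linarith
  qed

  \<comment> \<open>The term in which the derivative falls on the cutoff, by Young's inequality.\<close>
  have "- 2 * (\<integral>X. f4 X \<partial>lborel) = (\<integral>X. - 2 * f4 X \<partial>lborel)" by simp
  also have "\<dots> \<le> (\<integral>X. inverse \<mu> / R * (indicator shell X * (norm (gradu X))\<^sup>2 + 64 * (indicator ?D X * (lag_diff X)\<^sup>2)) \<partial>lborel)"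
  proof (rule integral_mono)
    show "- 2 * f4 X \<le> inverse \<mu> / R * (indicator shell X * (norm (gradu X))\<^sup>2 + 64 * (indicator ?D X * (lag_diff X)\<^sup>2))" for X
    proof (cases "X \<in> ?D")
      case True
      then have X: "X \<in> shell"
        using cyl_cutoff_eq_0[OF R, of "fst X" x\<^sub>0 "snd X"] cyl_cutoff_plateau[OF R, of "fst X" x\<^sub>0 "snd X"]
        by (cases X) (force simp: shell_def)
      have "\<bar>2 * form (A X) (gradu X) (lag_diff X *\<^sub>R \<phi>' X)\<bar> \<le> energy X (gradu X) / R + R * energy X (lag_diff X *\<^sub>R \<phi>' X)"
        using R by (intro form_young symmetric energy_bounds) auto
      also have "\<dots> \<le> inverse \<mu> * (norm (gradu X))\<^sup>2 / R + R * (inverse \<mu> * ((lag_diff X)\<^sup>2 * (64 / R\<^sup>2)))"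
      proof (intro add_mono divide_right_mono mult_left_mono energy_bounds)
        have "energy X (lag_diff X *\<^sub>R \<phi>' X) \<le> inverse \<mu> * ((lag_diff X)\<^sup>2 * (norm (\<phi>' X))\<^sup>2)"
          using energy_bounds(2)[of X "lag_diff X *\<^sub>R \<phi>' X"] by (simp add: power_mult_distrib)
        also have "\<dots> \<le> inverse \<mu> * ((lag_diff X)\<^sup>2 * (64 / R\<^sup>2))"
          using \<mu>_pos by (intro mult_left_mono norm_cyl_cutoff_grad[OF R]) auto
        finally show "energy X (lag_diff X *\<^sub>R \<phi>' X) \<le> inverse \<mu> * ((lag_diff X)\<^sup>2 * (64 / R\<^sup>2))" .
      qed (use R in auto)
      also have "\<dots> = inverse \<mu> / R * ((norm (gradu X))\<^sup>2 + 64 * (lag_diff X)\<^sup>2)"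
        using R \<mu>_pos by (simp add: field_simps power2_eq_square)
      finally have "- (2 * form (A X) (gradu X) (lag_diff X *\<^sub>R \<phi>' X)) \<le> inverse \<mu> / R * ((norm (gradu X))\<^sup>2 + 64 * (lag_diff X)\<^sup>2)"
        by linarith
      then show ?thesis
        using True X form_commute[OF symmetric, of X "gradu X" "\<phi>' X"] by (simp add: f4_def form_scaleR_right)
    next
      case False
      then have "f4 X = 0" by (auto simp: f4_def indicator_def)
      then show ?thesis using \<mu>_pos R by simp
    qed
    show "integrable lborel (\<lambda>X. inverse \<mu> / R * (indicator shell X * (norm (gradu X))\<^sup>2 + 64 * (indicator ?D X * (lag_diff X)\<^sup>2)))"
      by (intro integrable_mult_right Bochner_Integration.integrable_add integrable_shell integral_lag_diff_sq_le(1))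
  qed (use i4 in simp)
  also have "\<dots> = inverse \<mu> / R * (I_shell + 64 * (\<integral>X. indicator ?D X * (lag_diff X)\<^sup>2 \<partial>lborel))"
    unfolding I_shell_def using integrable_shell integral_lag_diff_sq_le(1) by simp
  also have "\<dots> \<le> inverse \<mu> / R * (I_shell + 64 * I_shell)"
    using \<mu>_pos R integral_lag_diff_sq_le(2) by (intro mult_left_mono) auto
  finally have f4_le: "- 2 * (\<integral>X. f4 X \<partial>lborel) \<le> 65 * inverse \<mu> / R * I_shell" by (simp add: mult_ac)
  show ?thesis using identity f2_le f4_le by (simp add: f1_def)
qed

text \<open>
  On the slab over $B(x_0,R)$ the cutoff is $1$, and $|p|^2 \le 2|p-r|^2 + 2|r|^2$ where $r$ is the tangential gradient at
  height \<open>a\<close>.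
\<close>

lemma slab_estimate:
  "(\<integral>X. indicator (ball x\<^sub>0 R \<times> {a<..<1}) X * (norm (gradu X))\<^sup>2 \<partial>lborel)
    \<le> (2 / \<mu>\<^sup>2 + 2) * I_bottom + 130 / \<mu>\<^sup>2 / R * I_shell"
proof -
  let ?O = "{X :: (real ^ 'n) \<times> real. a < snd X}"
  obtain B where B: "0 \<le> B" "\<And>X. X \<in> test_region \<Longrightarrow> (norm (gradu X))\<^sup>2 \<le> B" "\<And>X. X \<in> test_region \<Longrightarrow> (norm (lag_grad X))\<^sup>2 \<le> B"
    "\<And>X. X \<in> test_region \<Longrightarrow> (norm (gradu X - lag_grad X))\<^sup>2 \<le> 4 * B" using gradients_bounded by blast
  let ?f1 = "\<lambda>X. indicator ?O X * (\<phi> X * energy X (gradu X - lag_grad X))"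
  have i1: "integrable lborel ?f1" by (rule integrable_cutoff_energy[OF _ _ _ B(4)]) auto
  have "(\<integral>X. indicator (ball x\<^sub>0 R \<times> {a<..<1}) X * (norm (gradu X))\<^sup>2 \<partial>lborel)
    \<le> (\<integral>X. 2 / \<mu> * ?f1 X + 2 * (indicator {a<..1 + a} (snd X) * bottom_density (fst X)) \<partial>lborel)"
  proof (rule integral_mono)
    show "integrable lborel (\<lambda>X. indicator (ball x\<^sub>0 R \<times> {a<..<1}) X * (norm (gradu X))\<^sup>2)"
    proof (rule integrable_on_test_region[where B=B])
      have [measurable]: "ball x\<^sub>0 R \<times> {a<..<1} \<in> sets borel" by (simp add: borel_prod[symmetric])
      show "(\<lambda>X. indicator (ball x\<^sub>0 R \<times> {a<..<1}) X * (norm (gradu X))\<^sup>2) \<in> borel_measurable borel" by measurable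
    qed (use B R in \<open>auto simp: test_region_def indicator_def\<close>)
    show "integrable lborel (\<lambda>X. 2 / \<mu> * ?f1 X + 2 * (indicator {a<..1 + a} (snd X) * bottom_density (fst X)))"
      using i1 integral_bottom_density(1) by simp
    show "indicator (ball x\<^sub>0 R \<times> {a<..<1}) X * (norm (gradu X))\<^sup>2
      \<le> 2 / \<mu> * ?f1 X + 2 * (indicator {a<..1 + a} (snd X) * bottom_density (fst X))" for X
    proof (cases "X \<in> ball x\<^sub>0 R \<times> {a<..<1}")
      case True
      then have "\<phi> X = 1" using cyl_cutoff_plateau[OF R, of "fst X" x\<^sub>0 "snd X"] R by (cases X) auto
      moreover have "bottom_density (fst X) = (norm (lag_grad X))\<^sup>2"
        using True a R by (auto simp: lag_grad_sq_low)
      moreover have "(norm (gradu X - lag_grad X))\<^sup>2 \<le> energy X (gradu X - lag_grad X) / \<mu>"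
        using energy_bounds(1)[of "gradu X - lag_grad X" X] \<mu>_pos by (simp add: field_simps)
      ultimately show ?thesis
        using True a norm_diff_sq_bound[of "gradu X" "lag_grad X"] by auto
    next
      case False
      note bottom_density_nonneg[of "fst X"]
      moreover have "0 \<le> ?f1 X" by (intro mult_nonneg_nonneg cyl_cutoff_bounds[OF R] energy_bounds) simp
      ultimately show ?thesis using False \<mu>_pos by simp
    qed
  qed
  also have "\<dots> = 2 / \<mu> * (\<integral>X. ?f1 X \<partial>lborel) + 2 * I_bottom"
    using i1 integral_bottom_density by simp
  also have "\<dots> \<le> 2 / \<mu> * (inverse \<mu> * I_bottom + 65 * inverse \<mu> / R * I_shell) + 2 * I_bottom"
    using \<mu>_pos by (intro add_right_mono mult_left_mono cutoff_energy_inequality) auto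
  also have "\<dots> = (2 / \<mu>\<^sup>2 + 2) * I_bottom + 130 / \<mu>\<^sup>2 / R * I_shell"
    using \<mu>_pos R by (simp add: field_simps power2_eq_square)
  finally show ?thesis .
qed

lemma estimate_above_height:
  assumes int: "integrable lborel (\<lambda>X. indicator (T - cyl x\<^sub>0 R) X * (norm (grad u X))\<^sup>2)"
  shows "(\<integral>X. indicator (ball x\<^sub>0 R \<times> {a<..<1}) X * (norm (grad u X))\<^sup>2 \<partial>lborel)
    \<le> (2 / \<mu>\<^sup>2 + 2) *
        (\<integral>x. indicator (ball x\<^sub>0 (2 * R)) x * (\<Sum>k\<in>UNIV. (partial_deriv (Some k) u (x, a))\<^sup>2) \<partial>lborel)
      + 130 / \<mu>\<^sup>2 / R * (\<integral>X. indicator (T - cyl x\<^sub>0 R) X * (norm (grad u X))\<^sup>2 \<partial>lborel)"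
proof -
  have "I_shell \<le> (\<integral>X. indicator (T - cyl x\<^sub>0 R) X * (norm (grad u X))\<^sup>2 \<partial>lborel)"
    unfolding I_shell_def
  proof (rule integral_mono[OF integrable_shell int])
    show "indicator shell X * (norm (gradu X))\<^sup>2 \<le> indicator (T - cyl x\<^sub>0 R) X * (norm (grad u X))\<^sup>2" for X
    proof (cases "X \<in> shell")
      case True
      then have "X \<in> T - cyl x\<^sub>0 R" using shell_subset_test_region test_region_subset_T by (auto simp: shell_def cyl_def)
      then show ?thesis using True by (simp add: gradu_def)
    qed simp
  qed
  then have "130 / \<mu>\<^sup>2 / R * I_shell \<le> 130 / \<mu>\<^sup>2 / R * (\<integral>X. indicator (T - cyl x\<^sub>0 R) X * (norm (grad u X))\<^sup>2 \<partial>lborel)"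
    using R by (intro mult_left_mono) auto
  moreover have "I_bottom =
      (\<integral>x. indicator (ball x\<^sub>0 (2 * R)) x * (\<Sum>k\<in>UNIV. (partial_deriv (Some k) u (x, a))\<^sup>2) \<partial>lborel)"
    unfolding I_bottom_def
  proof (intro Bochner_Integration.integral_cong refl)
    fix x
    show "bottom_density x = indicator (ball x\<^sub>0 (2 * R)) x * (\<Sum>k\<in>UNIV. (partial_deriv (Some k) u (x, a))\<^sup>2)"
    proof (cases "x \<in> ball x\<^sub>0 (2 * R)")
      case True
      then have "(x, a) \<in> T" using a R by (simp add: cyl_def)
      then show ?thesis by (simp add: gradu_def grad_def)
    qed simp
  qed
  moreover have "(\<integral>X. indicator (ball x\<^sub>0 R \<times> {a<..<1}) X * (norm (gradu X))\<^sup>2 \<partial>lborel)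
      = (\<integral>X. indicator (ball x\<^sub>0 R \<times> {a<..<1}) X * (norm (grad u X))\<^sup>2 \<partial>lborel)"
    using R a by (intro Bochner_Integration.integral_cong) (auto simp: indicator_def gradu_def cyl_def)
  ultimately show ?thesis using slab_estimate by simp
qed

end


section \<open>The limit at the boundary\<close>

locale dirichlet_solution = cylinder_solution \<mu> A x\<^sub>0 R u
  for \<mu> :: real
    and A :: "(real ^ 'n::finite) \<times> real \<Rightarrow> real ^ 'n option ^ 'n option"
    and x\<^sub>0 :: "real ^ 'n" and R :: real
    and u :: "(real ^ 'n) \<times> real \<Rightarrow> real" +
  fixes f :: "real ^ 'n \<Rightarrow> real"
  assumes C1: "C1_closure T u"
    and boundary: "\<And>x. x \<in> ball x\<^sub>0 (3 * R) \<Longrightarrow> u (x, 0) = f x"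
begin

lemma closure_T: "closure T = cball x\<^sub>0 (3 * R) \<times> {0..3 * R}"
  using R by (simp add: cyl_def closure_Times)

lemma T_subset_closure: "X \<in> T \<Longrightarrow> X \<in> closure T" using closure_subset by blast

text \<open>
  The continuous extension of a partial derivative to the closure. At boundary points the derivative of $u$ itself is
  not available, since the values of $u$ outside the closure are arbitrary.
\<close>

definition du_closure :: "'n option \<Rightarrow> (real ^ 'n) \<times> real \<Rightarrow> real"
  where "du_closure i = (SOME g. continuous_on (closure T) g \<and> (\<forall>X\<in>T. g X = partial_deriv i u X))"

lemma du_closure: "continuous_on (closure T) (du_closure i)" "X \<in> T \<Longrightarrow> du_closure i X = partial_deriv i u X"
proof -
  have "\<exists>g. continuous_on (closure T) g \<and> (\<forall>X\<in>T. g X = partial_deriv i u X)"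
    using C1 unfolding C1_closure_def by blast
  from someI_ex[OF this, folded du_closure_def]
  show "continuous_on (closure T) (du_closure i)" "X \<in> T \<Longrightarrow> du_closure i X = partial_deriv i u X"
    by blast+
qed

definition tangential :: "(real ^ 'n) \<times> real \<Rightarrow> real ^ 'n"
  where "tangential X = (\<chi> k. du_closure (Some k) X)"

lemma tangential_continuous: "continuous_on (closure T) tangential"
  unfolding tangential_def by (intro continuous_on_vec_lambda du_closure)

lemma compact_closure_T: "compact (closure T)"
  unfolding closure_T by (intro compact_Times) auto

lemma grad_bounded:
  "\<exists>B\<ge>0. (\<forall>X\<in>T. (norm (grad u X))\<^sup>2 \<le> B) \<and> (\<forall>X\<in>closure T. (norm (tangential X))\<^sup>2 \<le> B)"
proof -
  let ?s = "\<lambda>X. \<Sum>i\<in>UNIV. (du_closure i X)\<^sup>2"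
  have "compact (?s ` closure T)"
    by (intro compact_continuous_image continuous_intros du_closure compact_closure_T)
  then have "bounded (?s ` closure T)" by (rule compact_imp_bounded)
  then obtain B where "\<forall>X\<in>closure T. norm (?s X) \<le> B"
    unfolding bounded_iff ball_simps(9) by (rule exE)
  then have B: "?s X \<le> B" if "X \<in> closure T" for X
    using that abs_le_D1 by (metis real_norm_def)
  have "(norm (grad u X))\<^sup>2 \<le> B" if "X \<in> T" for X
    using B[OF T_subset_closure[OF that]] that by (simp add: norm_sq_eq_sum grad_def du_closure(2))
  moreover have "(norm (tangential X))\<^sup>2 \<le> B" if "X \<in> closure T" for X
    by (rule order_trans[OF _ B[OF that]]) (simp add: norm_sq_eq_sum tangential_def sum_UNIV_option)
  moreover have "0 \<le> B"
  proof -
    have "(x\<^sub>0, 0) \<in> closure T" using R by (simp add: closure_T)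
    from B[OF this] show ?thesis by (rule order_trans[rotated]) (simp add: sum_nonneg)
  qed
  ultimately show ?thesis by blast
qed

text \<open>
  The functions $u(\cdot,h_n)$ converge to $f$, and their derivatives converge uniformly, by the uniform
  continuity of the extended derivatives on the compact closure; hence the limit is differentiable and its derivative is the limit
  of the derivatives.
\<close>

lemma grad_x_eq_tangential:
  assumes x: "x \<in> ball x\<^sub>0 (3 * R)"
  shows "grad_x f x = tangential (x, 0)"
proof -
  let ?S = "ball x\<^sub>0 (3 * R)"
  define h where "h n = 1 / real (Suc n)" for n
  have h: "0 < h n" "h n \<le> 1" for n by (auto simp: h_def)
  have h_lim: "h \<longlonglongrightarrow> 0"
    using LIMSEQ_inverse_real_of_nat by (simp add: h_def [abs_def] inverse_eq_divide)
  have inT: "(y, h n) \<in> T" if "y \<in> ?S" for y n using that h[of n] R by (simp add: cyl_def)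
  have in0: "(y, 0) \<in> closure T" if "y \<in> ?S" for y using that R by (simp add: closure_T)
  have u_lim: "(\<lambda>n. u (y, h n)) \<longlonglongrightarrow> u (y, 0)" if "y \<in> ?S" for y
  proof -
    have "continuous_on (closure T) u" using C1 by (simp add: C1_closure_def)
    then show ?thesis
      by (rule continuous_on_tendsto_compose)
        (use in0[OF that] T_subset_closure[OF inT[OF that]] h_lim in \<open>auto intro!: tendsto_intros\<close>)
  qed
  have "\<exists>F. \<forall>y\<in>?S. (\<lambda>n. u (y, h n)) \<longlonglongrightarrow> F y \<and> (F has_derivative (\<lambda>v. tangential (y, 0) \<bullet> v)) (at y within ?S)"
  proof (rule has_derivative_sequence)
    show "convex ?S" by simp
    show "((\<lambda>y. u (y, h n)) has_derivative (\<lambda>v. tangential (y, h n) \<bullet> v)) (at y within ?S)" if "y \<in> ?S" for n y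
    proof -
      define D where "D = frechet_derivative u (at (y, h n))"
      have D: "(u has_derivative D) (at (y, h n))"
        using u_differentiable[OF inT[OF that, of n]] by (simp add: D_def frechet_derivative_works)
      then interpret D: linear D by (rule has_derivative_linear)
      have "((\<lambda>y. (y, h n)) has_derivative (\<lambda>v. (v, 0))) (at y)"
        by (auto intro!: derivative_eq_intros)
      from has_derivative_compose[OF this D]
      have "((\<lambda>y. u (y, h n)) has_derivative (\<lambda>v. D (v, 0))) (at y)" .
      moreover have "D (v, 0) = tangential (y, h n) \<bullet> v" for v
      proof -
        have "(v, 0) = (\<Sum>k\<in>UNIV. v $ k *\<^sub>R (axis k 1, 0 :: real))"
          using basis_expansion[of v] by (simp add: prod_eq_iff fst_sum snd_sum scalar_mult_eq_scaleR)
        then have "D (v, 0) = D (\<Sum>k\<in>UNIV. v $ k *\<^sub>R (axis k 1, 0 :: real))" by (rule arg_cong)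
        also have "\<dots> = (\<Sum>k\<in>UNIV. v $ k * D (axis k 1, 0))"
          by (simp only: D.sum D.scale real_scaleR_def)
        also have "\<dots> = tangential (y, h n) \<bullet> v"
          by (simp add: tangential_def inner_vec_def du_closure(2)[OF inT[OF that]] partial_deriv_def D_def mult.commute)
        finally show ?thesis .
      qed
      ultimately have "((\<lambda>y. u (y, h n)) has_derivative (\<lambda>v. tangential (y, h n) \<bullet> v)) (at y)"
        by (simp only:)
      then show ?thesis by (rule has_derivative_at_withinI)
    qed
    show "\<forall>\<^sub>F n in sequentially. \<forall>y\<in>?S. \<forall>v. norm (tangential (y, h n) \<bullet> v - tangential (y, 0) \<bullet> v) \<le> \<epsilon> * norm v"
      if "\<epsilon> > 0" for \<epsilon>
    proof -
      have uc: "uniformly_continuous_on (closure T) tangential"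
        by (rule compact_uniformly_continuous[OF tangential_continuous compact_closure_T])
      obtain \<delta> where \<delta>: "\<delta> > 0" "\<And>X Y. X \<in> closure T \<Longrightarrow> Y \<in> closure T \<Longrightarrow> dist Y X < \<delta> \<Longrightarrow>
          dist (tangential Y) (tangential X) < \<epsilon>"
        by (rule uniformly_continuous_onE[OF uc \<open>\<epsilon> > 0\<close>]) (rule that)
      have "eventually (\<lambda>n. h n < \<delta>) sequentially"
        using order_tendstoD(2)[OF h_lim \<delta>(1)] .
      then show ?thesis
      proof eventually_elim
        case (elim n)
        show ?case
        proof (intro ballI allI)
          fix y v :: "real ^ 'n" assume y: "y \<in> ?S"
          have "dist (tangential (y, h n)) (tangential (y, 0)) < \<epsilon>"
            using h[of n] elim by (intro \<delta>(2) in0 y T_subset_closure inT) (simp add: dist_Pair_Pair)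
          then have "norm (tangential (y, h n) - tangential (y, 0)) * norm v \<le> \<epsilon> * norm v"
            by (intro mult_right_mono) (auto simp: dist_norm)
          then show "norm (tangential (y, h n) \<bullet> v - tangential (y, 0) \<bullet> v) \<le> \<epsilon> * norm v"
            unfolding inner_diff_left[symmetric] real_norm_def
            by (rule order_trans[OF Cauchy_Schwarz_ineq2])
        qed
      qed
    qed
    show "x \<in> ?S" by fact
    show "(\<lambda>n. u (x, h n)) \<longlonglongrightarrow> u (x, 0)" by (rule u_lim[OF x])
  qed
  then obtain F where F: "\<And>y. y \<in> ?S \<Longrightarrow> (\<lambda>n. u (y, h n)) \<longlonglongrightarrow> F y"
    "\<And>y. y \<in> ?S \<Longrightarrow> (F has_derivative (\<lambda>v. tangential (y, 0) \<bullet> v)) (at y within ?S)" by blast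
  have Ff: "f y = F y" if "y \<in> ?S" for y
    using LIMSEQ_unique[OF F(1)[OF that] u_lim[OF that]] boundary[OF that] by simp
  have "(f has_derivative (\<lambda>v. tangential (x, 0) \<bullet> v)) (at x within ?S)"
    by (rule has_derivative_transform[OF x Ff F(2)[OF x]])
  then have "(f has_derivative (\<lambda>v. tangential (x, 0) \<bullet> v)) (at x)"
    using x by (simp add: at_within_open[OF _ open_ball])
  then have "frechet_derivative f (at x) = (\<lambda>v. tangential (x, 0) \<bullet> v)"
    by (rule frechet_derivative_at[symmetric])
  then show ?thesis by (simp add: grad_x_def vec_eq_iff inner_axis)
qed

lemma grad_sq_measurable:
  assumes "S \<subseteq> T" and [measurable]: "S \<in> sets borel"
  shows "(\<lambda>X. indicator S X * (norm (grad u X))\<^sup>2) \<in> borel_measurable borel"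
proof -
  have "(\<lambda>X. indicator S X * (norm (gradu X))\<^sup>2) \<in> borel_measurable borel"
    unfolding norm_sq_eq_sum by measurable
  moreover have "(\<lambda>X. indicator S X * (norm (gradu X))\<^sup>2) = (\<lambda>X. indicator S X * (norm (grad u X))\<^sup>2)"
    using assms(1) by (intro ext) (auto simp: gradu_def indicator_def)
  ultimately show ?thesis by simp
qed

lemma bounded_T: "bounded T"
  by (rule bounded_subset[OF compact_imp_bounded[OF compact_closure_T] closure_subset])

lemma grad_sq_integrable:
  assumes "S \<subseteq> T" and "S \<in> sets borel"
  shows "integrable lborel (\<lambda>X. indicator S X * (norm (grad u X))\<^sup>2)"
proof -
  obtain B where B: "0 \<le> B" "\<And>X. X \<in> T \<Longrightarrow> (norm (grad u X))\<^sup>2 \<le> B" using grad_bounded by blast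
  show ?thesis
  proof (rule integrable_bounded_support[OF grad_sq_measurable[OF assms] bounded_T])
    show "indicator S X * (norm (grad u X))\<^sup>2 = 0" if "X \<notin> T" for X
    proof -
      have "X \<notin> S" using that assms(1) by blast
      then show ?thesis by simp
    qed
    show "\<bar>indicator S X * (norm (grad u X))\<^sup>2\<bar> \<le> B" for X
    proof (cases "X \<in> S")
      case True
      then have "X \<in> T" using assms(1) by blast
      then show ?thesis using True B(2)[of X] by simp
    qed (use B(1) in simp)
  qed
qed

lemma cyl_borel [measurable]: "cyl x\<^sub>0 s \<in> sets borel"
  unfolding cyl_def by (intro borel_open open_Times) auto

text \<open>
  The bounds on the first derivatives in the closure dominate both integrals that depend on the height,
  so that the estimate above height $1/(n+2)$ passes to the limit.
\<close>

lemma estimate_at_boundary: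
  "(\<integral>X. indicator (ball x\<^sub>0 R \<times> {0<..<1}) X * (norm (grad u X))\<^sup>2 \<partial>lborel)
    \<le> (2 / \<mu>\<^sup>2 + 2) * (\<integral>x. indicator (ball x\<^sub>0 (2 * R)) x * (norm (grad_x f x))\<^sup>2 \<partial>lborel)
      + 130 / \<mu>\<^sup>2 / R * (\<integral>X. indicator (T - cyl x\<^sub>0 R) X * (norm (grad u X))\<^sup>2 \<partial>lborel)"
proof -
  obtain B where B: "0 \<le> B" "\<And>X. X \<in> T \<Longrightarrow> (norm (grad u X))\<^sup>2 \<le> B"
    "\<And>X. X \<in> closure T \<Longrightarrow> (norm (tangential X))\<^sup>2 \<le> B" using grad_bounded by blast
  define h where "h n = 1 / real (n + 2)" for n :: nat
  have h: "0 < h n" "h n < 1" for n by (auto simp: h_def)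
  have h_lim: "h \<longlonglongrightarrow> 0"
    unfolding h_def [abs_def] using LIMSEQ_ignore_initial_segment[OF lim_1_over_n, of 2] by simp
  have estimate: "(\<integral>X. indicator (ball x\<^sub>0 R \<times> {h n<..<1}) X * (norm (grad u X))\<^sup>2 \<partial>lborel)
    \<le> (2 / \<mu>\<^sup>2 + 2) * (\<integral>x. indicator (ball x\<^sub>0 (2 * R)) x * (norm (tangential (x, h n)))\<^sup>2 \<partial>lborel)
      + 130 / \<mu>\<^sup>2 / R * (\<integral>X. indicator (T - cyl x\<^sub>0 R) X * (norm (grad u X))\<^sup>2 \<partial>lborel)" for n
  proof -
    have "solution_above_height \<mu> A x\<^sub>0 R u (h n)" using h by unfold_locales
    note est = solution_above_height.estimate_above_height[OF this grad_sq_integrable]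
    have "(\<integral>x. indicator (ball x\<^sub>0 (2 * R)) x * (\<Sum>k\<in>UNIV. (partial_deriv (Some k) u (x, h n))\<^sup>2) \<partial>lborel)
      = (\<integral>x. indicator (ball x\<^sub>0 (2 * R)) x * (norm (tangential (x, h n)))\<^sup>2 \<partial>lborel)"
    proof (intro Bochner_Integration.integral_cong refl)
      fix x
      show "indicator (ball x\<^sub>0 (2 * R)) x * (\<Sum>k\<in>UNIV. (partial_deriv (Some k) u (x, h n))\<^sup>2) =
        indicator (ball x\<^sub>0 (2 * R)) x * (norm (tangential (x, h n)))\<^sup>2"
      proof (cases "x \<in> ball x\<^sub>0 (2 * R)")
        case True
        then have "(x, h n) \<in> T" using h[of n] R by (simp add: cyl_def)
        then show ?thesis by (simp add: norm_sq_eq_sum tangential_def du_closure(2))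
      qed simp
    qed
    then show ?thesis using est by simp
  qed
  have slab: "ball x\<^sub>0 R \<times> {0<..<1} \<subseteq> T" using R by (auto simp: cyl_def)
  have slab_n: "ball x\<^sub>0 R \<times> {h n<..<1} \<subseteq> T" for n using R less_trans[OF h(1)] by (fastforce simp: cyl_def)
  have m: "ball x\<^sub>0 R \<times> {s<..<1} \<in> sets borel" for s :: real
    by (intro borel_open open_Times) auto
  have ball_int: "integrable lborel (\<lambda>x. B * indicator (ball x\<^sub>0 (2 * R)) x)"
    by (intro integrable_mult_right integrable_real_indicator) (simp_all add: emeasure_bounded_finite[simplified])
  have inT: "(x, h n) \<in> closure T" "(x, 0) \<in> closure T" if "x \<in> ball x\<^sub>0 (2 * R)" for x n
    using that R h[of n] by (auto simp: closure_T)
  have meas: "(\<lambda>x. indicator (ball x\<^sub>0 (2 * R)) x * (norm (tangential (x, t)))\<^sup>2) \<in> borel_measurable borel"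
    if "0 \<le> t" "t \<le> 1" for t
  proof -
    have "continuous_on (ball x\<^sub>0 (2 * R)) (\<lambda>x. (norm (tangential (x, t)))\<^sup>2)"
      using R that by (intro continuous_intros continuous_on_compose2[OF tangential_continuous]) (auto simp: closure_T)
    from borel_measurable_continuous_on_indicator[OF _ this] show ?thesis by simp
  qed
  have lhs: "(\<lambda>n. \<integral>X. indicator (ball x\<^sub>0 R \<times> {h n<..<1}) X * (norm (grad u X))\<^sup>2 \<partial>lborel)
      \<longlonglongrightarrow> (\<integral>X. indicator (ball x\<^sub>0 R \<times> {0<..<1}) X * (norm (grad u X))\<^sup>2 \<partial>lborel)"
  proof (rule integral_dominated_convergence)
    show "integrable lborel (\<lambda>X. indicator (ball x\<^sub>0 R \<times> {0<..<1}) X * (norm (grad u X))\<^sup>2)"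
      by (rule grad_sq_integrable[OF slab m])
    show "AE X in lborel. norm (indicator (ball x\<^sub>0 R \<times> {h n<..<1}) X * (norm (grad u X))\<^sup>2)
        \<le> indicator (ball x\<^sub>0 R \<times> {0<..<1}) X * (norm (grad u X))\<^sup>2" for n
      using h[of n] by (intro AE_I2) (auto simp: indicator_def)
    show "AE X in lborel. (\<lambda>n. indicator (ball x\<^sub>0 R \<times> {h n<..<1}) X * (norm (grad u X))\<^sup>2)
        \<longlonglongrightarrow> indicator (ball x\<^sub>0 R \<times> {0<..<1}) X * (norm (grad u X))\<^sup>2"
    proof (intro AE_I2 tendsto_mult tendsto_const)
      fix X :: "(real ^ 'n) \<times> real"
      show "(\<lambda>n. indicator (ball x\<^sub>0 R \<times> {h n<..<1}) X :: real) \<longlonglongrightarrow> indicator (ball x\<^sub>0 R \<times> {0<..<1}) X"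
      proof (cases "0 < snd X")
        case True
        then have "eventually (\<lambda>n. h n < snd X) sequentially" by (rule order_tendstoD(2)[OF h_lim])
        then have "eventually (\<lambda>n. indicator (ball x\<^sub>0 R \<times> {h n<..<1}) X = (indicator (ball x\<^sub>0 R \<times> {0<..<1}) X :: real)) sequentially"
          by eventually_elim (use True in \<open>auto simp: indicator_def\<close>)
        then show ?thesis by (rule tendsto_eventually)
      next
        case False
        then have "\<not> h n < snd X" for n using h(1)[of n] by linarith
        then show ?thesis using False by (simp add: indicator_def mem_Times_iff)
      qed
    qed
  qed (rule borel_measurable_integrable grad_sq_integrable slab slab_n m)+
  have rhs: "(\<lambda>n. \<integral>x. indicator (ball x\<^sub>0 (2 * R)) x * (norm (tangential (x, h n)))\<^sup>2 \<partial>lborel)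
      \<longlonglongrightarrow> (\<integral>x. indicator (ball x\<^sub>0 (2 * R)) x * (norm (tangential (x, 0)))\<^sup>2 \<partial>lborel)"
  proof (rule integral_dominated_convergence[OF _ _ ball_int])
    show "AE x in lborel. norm (indicator (ball x\<^sub>0 (2 * R)) x * (norm (tangential (x, h n)))\<^sup>2)
        \<le> B * indicator (ball x\<^sub>0 (2 * R)) x" for n
      using B(3)[OF inT(1)] by (intro AE_I2) (auto simp: indicator_def)
    show "AE x in lborel. (\<lambda>n. indicator (ball x\<^sub>0 (2 * R)) x * (norm (tangential (x, h n)))\<^sup>2)
        \<longlonglongrightarrow> indicator (ball x\<^sub>0 (2 * R)) x * (norm (tangential (x, 0)))\<^sup>2"
    proof (rule AE_I2)
      fix x
      show "(\<lambda>n. indicator (ball x\<^sub>0 (2 * R)) x * (norm (tangential (x, h n)))\<^sup>2)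
        \<longlonglongrightarrow> indicator (ball x\<^sub>0 (2 * R)) x * (norm (tangential (x, 0)))\<^sup>2"
      proof (cases "x \<in> ball x\<^sub>0 (2 * R)")
        case True
        have "(\<lambda>n. tangential (x, h n)) \<longlonglongrightarrow> tangential (x, 0)"
          by (rule continuous_on_tendsto_compose[OF tangential_continuous])
            (use inT[OF True] h_lim in \<open>auto intro!: tendsto_intros\<close>)
        then show ?thesis by (intro tendsto_intros)
      qed simp
    qed
  qed (simp_all add: meas h less_imp_le)
  have f: "(\<integral>x. indicator (ball x\<^sub>0 (2 * R)) x * (norm (tangential (x, 0)))\<^sup>2 \<partial>lborel)
      = (\<integral>x. indicator (ball x\<^sub>0 (2 * R)) x * (norm (grad_x f x))\<^sup>2 \<partial>lborel)"
  proof (intro Bochner_Integration.integral_cong refl)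
    fix x
    show "indicator (ball x\<^sub>0 (2 * R)) x * (norm (tangential (x, 0)))\<^sup>2
      = indicator (ball x\<^sub>0 (2 * R)) x * (norm (grad_x f x))\<^sup>2"
    proof (cases "x \<in> ball x\<^sub>0 (2 * R)")
      case True
      then have "x \<in> ball x\<^sub>0 (3 * R)" using R by simp
      then show ?thesis by (simp only: grad_x_eq_tangential)
    qed simp
  qed
  show ?thesis
    unfolding f[symmetric]
    by (rule LIMSEQ_le[OF lhs tendsto_add[OF tendsto_mult[OF tendsto_const rhs] tendsto_const]])
      (use estimate in blast)
qed

lemma iterated_integral:
  "(LBINT t:{0<..<1}. (LBINT x:ball x\<^sub>0 R. (norm (grad u (x, t)))\<^sup>2))
    = (\<integral>X. indicator (ball x\<^sub>0 R \<times> {0<..<1}) X * (norm (grad u X))\<^sup>2 \<partial>lborel)"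
proof -
  have "ball x\<^sub>0 R \<times> {0<..<1::real} \<subseteq> T" using R by (auto simp: cyl_def)
  moreover have "ball x\<^sub>0 R \<times> {0<..<1::real} \<in> sets borel" by (intro borel_open open_Times) auto
  ultimately have "integrable lborel (\<lambda>X. indicator (ball x\<^sub>0 R \<times> {0<..<1}) X * (norm (grad u X))\<^sup>2)"
    by (rule grad_sq_integrable)
  then have "integrable (lborel \<Otimes>\<^sub>M lborel) (\<lambda>(x, t). indicator (ball x\<^sub>0 R \<times> {0<..<1}) (x, t) * (norm (grad u (x, t)))\<^sup>2)"
    by (simp only: lborel_prod case_prod_unfold prod.collapse)
  from lborel_pair.integral_snd[OF this]
  have "(\<integral>t. \<integral>x. indicator (ball x\<^sub>0 R \<times> {0<..<1}) (x, t) * (norm (grad u (x, t)))\<^sup>2 \<partial>lborel \<partial>lborel)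
    = (\<integral>X. indicator (ball x\<^sub>0 R \<times> {0<..<1}) X * (norm (grad u X))\<^sup>2 \<partial>lborel)"
    by (simp only: lborel_prod case_prod_unfold prod.collapse)
  then show ?thesis
    unfolding set_lebesgue_integral_def real_scaleR_def indicator_times fst_conv snd_conv
      Bochner_Integration.integral_mult_right_zero[symmetric] mult.assoc[symmetric]
    by (simp only: mult.commute[of "indicator {0<..<1} _"])
qed

end

text \<open>
  One constant has to serve both terms; $130/\mu^2 + 2$ is at least $2/\mu^2 + 2$ and at least $130/\mu^2$.
\<close>

theorem lemma3p4:
  fixes \<mu> :: real
  assumes "CARD('n::finite) \<ge> 2" and "\<mu> > 0"
  shows "\<exists>C>0. \<forall>(A :: (real ^ 'n) \<times> real \<Rightarrow> real ^ 'n option ^ 'n option)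
           (x\<^sub>0 :: real ^ 'n) (R :: real) (u :: (real ^ 'n) \<times> real \<Rightarrow> real) (f :: real ^ 'n \<Rightarrow> real).
      smooth_matrix A \<longrightarrow>
      (\<forall>X. transpose (A X) = A X) \<longrightarrow>
      elliptic_matrix \<mu> A \<longrightarrow>
      (\<forall>x t. A (x, t + 1) = A (x, t)) \<longrightarrow>
      R > 10 \<longrightarrow>
      C1_closure (cyl x\<^sub>0 (3 * R)) u \<longrightarrow>
      Ck_on 2 (cyl x\<^sub>0 (3 * R)) u \<longrightarrow>
      (\<forall>X\<in>cyl x\<^sub>0 (3 * R). elliptic_op A u X = 0) \<longrightarrow>
      (\<forall>x\<in>ball x\<^sub>0 (3 * R). u (x, 0) = f x) \<longrightarrow>
      (LBINT t:{0<..<1}. (LBINT x:ball x\<^sub>0 R. (norm (grad u (x, t)))\<^sup>2))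
        \<le> C * (LBINT x:ball x\<^sub>0 (2 * R). (norm (grad_x f x))\<^sup>2)
          + C / R * (LBINT X:cyl x\<^sub>0 (3 * R) - cyl x\<^sub>0 R. (norm (grad u X))\<^sup>2)"
proof (intro exI[of _ "130 / \<mu>\<^sup>2 + 2"] conjI allI impI)
  show "0 < 130 / \<mu>\<^sup>2 + 2" using \<open>\<mu> > 0\<close> by (simp add: add_pos_pos)
next
  fix A :: "(real ^ 'n) \<times> real \<Rightarrow> real ^ 'n option ^ 'n option"
    and x\<^sub>0 :: "real ^ 'n" and R :: real and u :: "(real ^ 'n) \<times> real \<Rightarrow> real" and f :: "real ^ 'n \<Rightarrow> real"
  assume "smooth_matrix A" "\<forall>X. transpose (A X) = A X" "elliptic_matrix \<mu> A"
    "\<forall>x t. A (x, t + 1) = A (x, t)" and R: "R > 10"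
    and "C1_closure (cyl x\<^sub>0 (3 * R)) u" "Ck_on 2 (cyl x\<^sub>0 (3 * R)) u"
    "\<forall>X\<in>cyl x\<^sub>0 (3 * R). elliptic_op A u X = 0" "\<forall>x\<in>ball x\<^sub>0 (3 * R). u (x, 0) = f x"
  note asms = this
  interpret dirichlet_solution \<mu> A x\<^sub>0 R u f
  proof unfold_locales
    show "\<And>X. transpose (A X) = A X" using asms(2) by (rule spec)
    show "\<And>x t. A (x, t + 1) = A (x, t)" using asms(4) by simp
    show "\<And>X. X \<in> cyl x\<^sub>0 (3 * R) \<Longrightarrow> elliptic_op A u X = 0" using asms(8) by (rule bspec)
    show "\<And>x. x \<in> ball x\<^sub>0 (3 * R) \<Longrightarrow> u (x, 0) = f x" using asms(9) by (rule bspec)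
  qed fact+
  let ?F = "\<integral>x. indicator (ball x\<^sub>0 (2 * R)) x * (norm (grad_x f x))\<^sup>2 \<partial>lborel"
  let ?G = "\<integral>X. indicator (T - cyl x\<^sub>0 R) X * (norm (grad u X))\<^sup>2 \<partial>lborel"
  have "0 \<le> ?F" "0 \<le> ?G" by (auto intro!: integral_nonneg)
  have "2 / \<mu>\<^sup>2 + 2 \<le> 130 / \<mu>\<^sup>2 + 2" by (intro add_right_mono divide_right_mono) auto
  from mult_right_mono[OF this \<open>0 \<le> ?F\<close>]
  have F: "(2 / \<mu>\<^sup>2 + 2) * ?F \<le> (130 / \<mu>\<^sup>2 + 2) * ?F" .
  have "130 / \<mu>\<^sup>2 / R \<le> (130 / \<mu>\<^sup>2 + 2) / R" using R by (intro divide_right_mono) auto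
  from mult_right_mono[OF this \<open>0 \<le> ?G\<close>]
  have G: "130 / \<mu>\<^sup>2 / R * ?G \<le> (130 / \<mu>\<^sup>2 + 2) / R * ?G" .
  show "(LBINT t:{0<..<1}. (LBINT x:ball x\<^sub>0 R. (norm (grad u (x, t)))\<^sup>2))
        \<le> (130 / \<mu>\<^sup>2 + 2) * (LBINT x:ball x\<^sub>0 (2 * R). (norm (grad_x f x))\<^sup>2)
          + (130 / \<mu>\<^sup>2 + 2) / R * (LBINT X:cyl x\<^sub>0 (3 * R) - cyl x\<^sub>0 R. (norm (grad u X))\<^sup>2)"
    unfolding iterated_integral
    unfolding set_lebesgue_integral_def real_scaleR_def
    using estimate_at_boundary F G by linarith
qed

end
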